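(* Let $Z\subset\mathbb{R}^n$ be an $n$-dimensional lattice parallelepiped. Then $\mathrm{g}_i(Z)\leq \sigma_i(Z)$ for all $i=0,\dots,n$.
   Context: A lattice parallelepiped is a set $p+\sum_{i=1}^n[0,v_i]$ with $p,v_1,\dots,v_n\in\mathbb{Z}^n$. For an $n$-dimensional lattice polytope $P$ (vertices in $\mathbb{Z}^n$), $\#(kP\cap\mathbb{Z}^n)=\sum_{i=0}^n\mathrm{g}_i(P)k^i$ for all $k\in\mathbb{N}$ (Ehrhart polynomial), defining $\mathrm{g}_i(P)$. For a $0$-symmetric convex body $K$ with nonempty interior, $\lambda_i(K)=\min\{\lambda>0:\dim(\lambda K\cap\mathbb{Z}^n)\ge i\}$ (dimension of the affine hull). $DP=P-P$ and $\sigma_i(P)=\sigma_i(1/\lambda_1(DP),\dots,1/\lambda_n(DP))$, with $\sigma_i$ the $i$th elementary symmetric polynomial ($\sigma_0=1$). *)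

theory Defs
  imports "HOL-Analysis.Analysis" "HOL-Computational_Algebra.Polynomial"
begin

definition lattice :: "(real ^ 'n) set" where
  "lattice = {x. \<forall>i. x $ i \<in> \<int>}"

definition parallelepiped :: "real ^ 'n \<Rightarrow> ('n \<Rightarrow> real ^ 'n) \<Rightarrow> (real ^ 'n) set" where
  "parallelepiped p v = {p + (\<Sum>i\<in>UNIV. t i *\<^sub>R v i) | t. \<forall>i. 0 \<le> t i \<and> t i \<le> 1}"

definition ehrhart_poly :: "(real ^ 'n) set \<Rightarrow> real poly" where
  "ehrhart_poly P = (THE q. degree q \<le> CARD('n) \<and>
      (\<forall>k::nat. poly q (real k) = real (card (((\<lambda>x. real k *\<^sub>R x) ` P) \<inter> lattice))))"

definition ehrhart_coeff :: "(real ^ 'n) set \<Rightarrow> nat \<Rightarrow> real" where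
  "ehrhart_coeff P i = coeff (ehrhart_poly P) i"

definition diff_body :: "(real ^ 'n) set \<Rightarrow> (real ^ 'n) set" where
  "diff_body P = {x - y | x y. x \<in> P \<and> y \<in> P}"

definition succ_min :: "(real ^ 'n) set \<Rightarrow> nat \<Rightarrow> real" where
  "succ_min K i = Inf {t. t > 0 \<and> aff_dim (((\<lambda>x. t *\<^sub>R x) ` K) \<inter> lattice) \<ge> int i}"

definition sigma :: "(real ^ 'n) set \<Rightarrow> nat \<Rightarrow> real" where
  "sigma P i = (\<Sum>S\<in>{S. S \<subseteq> {1..CARD('n)} \<and> card S = i}.
                  \<Prod>j\<in>S. 1 / succ_min (diff_body P) j)"

end

theory Submission
  imports Defs
begin

text \<open>
  In the coordinates \<open>x = \<Sum>\<^sub>i t\<^sub>i v\<^sub>i\<close> the parallelepiped becomes the unit cube, \<open>\<int>\<^sup>n\<close> becomes a lattice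
  \<open>L \<supseteq> \<int>\<^sup>n\<close>, and \<open>\<lambda>\<^sub>i\<close> the successive minima of \<open>L\<close> for the maximum norm. Splitting the closed cube
  into half-open faces gives \<open>g\<^sub>i = \<Sum> h\<^sub>J\<close> over \<open>|J| = i\<close>, where \<open>h\<^sub>J = #(L \<inter> [0,1)\<^sup>J)\<close>.
  By Minkowski's second theorem for the cube, \<open>h\<^sub>J\<close> is at most the product of the inverse
  successive minima of \<open>L \<inter> \<real>\<^sup>J\<close>. The vectors of \<open>L\<close> of norm less than \<open>\<lambda>\<^sub>k\<close> span a subspace \<open>U\<^sub>k\<close> of
  dimension less than \<open>k\<close>, and exchange yields one bijection \<open>\<pi>\<close> from the coordinates to \<open>{1..n}\<close> such
  that the \<open>e\<^sub>j\<close> with \<open>\<pi> j \<ge> k\<close> are independent modulo \<open>U\<^sub>k\<close>, for all \<open>k\<close> at once. Then the minima of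
  \<open>L \<inter> \<real>\<^sup>J\<close> dominate those \<open>\<lambda>\<^bsub>\<pi> j\<^esub>\<close> with \<open>j \<in> J\<close>, so \<open>h\<^sub>J \<le> \<Prod> 1/\<lambda>\<^bsub>\<pi> j\<^esub>\<close>; summing over \<open>J\<close>
  gives \<open>\<sigma>\<^sub>i\<close>.
\<close>

section \<open>Half-open boxes in coordinate subspaces\<close>

lemma infnorm_Max_cart: "infnorm (x :: real ^ 'n) = Max (range (\<lambda>i. \<bar>x $ i\<bar>))"
proof -
  have "{\<bar>x $ i\<bar> |i. i \<in> UNIV} = range (\<lambda>i. \<bar>x $ i\<bar>)" by auto
  then show ?thesis by (simp add: infnorm_cart cSup_eq_Max)
qed

lemma infnorm_le_iff_cart: "infnorm (x :: real ^ 'n) \<le> r \<longleftrightarrow> (\<forall>i. \<bar>x $ i\<bar> \<le> r)"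
  unfolding infnorm_Max_cart by (subst Max_le_iff) auto

lemma infnorm_less_iff_cart: "infnorm (x :: real ^ 'n) < r \<longleftrightarrow> (\<forall>i. \<bar>x $ i\<bar> < r)"
  unfolding infnorm_Max_cart by (subst Max_less_iff) auto

lemma infnorm_sum_le: "infnorm (\<Sum>i\<in>A. f i) \<le> (\<Sum>i\<in>A. infnorm (f i))"
  for f :: "'a \<Rightarrow> 'b :: euclidean_space"
proof (induction A rule: infinite_finite_induct)
  case (insert a A)
  then show ?case using infnorm_triangle[of "f a" "\<Sum>i\<in>A. f i"] by simp
qed (simp_all add: infnorm_0)

section \<open>Coordinate subspaces and half-open boxes as fundamental domains\<close>

definition coord_space :: "'n set \<Rightarrow> (real ^ 'n) set" where
  "coord_space J = {x. \<forall>i. i \<notin> J \<longrightarrow> x $ i = 0}"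

definition box_on :: "'n set \<Rightarrow> real \<Rightarrow> (real ^ 'n) set" where
  "box_on J M = {x \<in> coord_space J. \<forall>i\<in>J. 0 \<le> x $ i \<and> x $ i < M}"

definition floor_on :: "'n set \<Rightarrow> real ^ 'n \<Rightarrow> real ^ 'n" where
  "floor_on J x = (\<chi> i. if i \<in> J then of_int \<lfloor>x $ i\<rfloor> else 0)"

lemma subspace_coord_space: "subspace (coord_space J)"
  by (auto simp: subspace_def coord_space_def)

lemma axis_in_coord_space: "j \<in> J \<Longrightarrow> axis j a \<in> coord_space J"
  by (auto simp: coord_space_def axis_def)

lemma coord_space_mono: "I \<subseteq> J \<Longrightarrow> coord_space I \<subseteq> coord_space J"
  by (auto simp: coord_space_def)

lemma coord_space_UNIV [simp]: "coord_space UNIV = UNIV"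
  by (simp add: coord_space_def)

lemma dim_coord_space: "dim (coord_space (J :: 'n::finite set)) = card J"
proof -
  let ?d = "(\<lambda>j. axis j 1 :: real ^ 'n) ` J"
  have "dim {x :: real ^ 'n. \<forall>i\<in>Basis. i \<notin> ?d \<longrightarrow> x \<bullet> i = 0} = card ?d"
    by (rule dim_substandard) (auto simp: axis_in_Basis_iff)
  moreover have "{x :: real ^ 'n. \<forall>i\<in>Basis. i \<notin> ?d \<longrightarrow> x \<bullet> i = 0} = coord_space J"
    by (auto simp: coord_space_def Basis_vec_def inner_axis axis_eq_axis image_iff)
  moreover have "card ?d = card J"
    by (intro card_image) (auto simp: inj_on_def axis_eq_axis)
  ultimately show ?thesis by simp
qed

lemma lattice_diff: "x \<in> lattice \<Longrightarrow> y \<in> lattice \<Longrightarrow> x - y \<in> lattice"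
  and lattice_add: "x \<in> lattice \<Longrightarrow> y \<in> lattice \<Longrightarrow> x + y \<in> lattice"
  and lattice_scale_int: "x \<in> lattice \<Longrightarrow> a \<in> \<int> \<Longrightarrow> a *\<^sub>R x \<in> lattice"
  and zero_in_lattice: "0 \<in> lattice"
  by (auto simp: lattice_def)

lemma axis_in_lattice: "axis j 1 \<in> lattice"
  by (auto simp: lattice_def axis_def)

lemma floor_on_in_lattice: "floor_on J x \<in> lattice \<inter> coord_space J"
  by (auto simp: lattice_def coord_space_def floor_on_def)

lemma box_on_diff_less:
  assumes "x \<in> box_on J M" "y \<in> box_on J M" "M > 0"
  shows "infnorm (x - y) < M"
  unfolding infnorm_less_iff_cart
proof
  fix i
  show "\<bar>(x - y) $ i\<bar> < M"
  proof (cases "i \<in> J")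
    case True
    then have "0 \<le> x $ i" "x $ i < M" "0 \<le> y $ i" "y $ i < M"
      using assms by (auto simp: box_on_def)
    then show ?thesis by (simp add: abs_less_iff)
  qed (use assms in \<open>auto simp: box_on_def coord_space_def\<close>)
qed

text \<open>The difference has norm below M, so u is an integer vector of norm below 1, hence 0.
  With \<open>reduce_into_box_on\<close> this makes \<open>box_on J M\<close> a fundamental domain
  of \<open>coord_space J\<close> modulo M times its integer points.\<close>

lemma box_on_congruent_eq:
  assumes "x \<in> box_on J M" "y \<in> box_on J M" "M > 0" "x - y = M *\<^sub>R u" "u \<in> lattice"
  shows "x = y"
proof -
  have "infnorm (M *\<^sub>R u) < M" using box_on_diff_less[OF assms(1-3)] assms(4) by simp
  then have "infnorm u < 1" using \<open>M > 0\<close> by (simp add: infnorm_mul)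
  then have "u $ i = 0" for i
    using \<open>u \<in> lattice\<close> unfolding infnorm_less_iff_cart
    by (auto simp: lattice_def dest!: spec[of _ i] elim!: Ints_cases)
  then have "u = 0" by (simp add: vec_eq_iff)
  then show ?thesis using assms(4) by simp
qed

lemma reduce_into_box_on:
  assumes "x \<in> coord_space J" "M > 0"
  shows "x - M *\<^sub>R floor_on J (x /\<^sub>R M) \<in> box_on J M"
proof -
  have "M * of_int \<lfloor>x $ i / M\<rfloor> \<le> x $ i" "x $ i - M * of_int \<lfloor>x $ i / M\<rfloor> < M" for i
  proof -
    define a :: real where "a = of_int \<lfloor>x $ i / M\<rfloor>"
    have "a \<le> x $ i / M" "x $ i / M < a + 1" unfolding a_def by linarith+
    then have "M * a \<le> x $ i" "x $ i - M * a < M"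
      using \<open>M > 0\<close> by (simp_all add: pos_le_divide_eq pos_divide_less_eq algebra_simps)
    then show "M * of_int \<lfloor>x $ i / M\<rfloor> \<le> x $ i" "x $ i - M * of_int \<lfloor>x $ i / M\<rfloor> < M"
      by (simp_all add: a_def)
  qed
  then show ?thesis using assms(1)
    by (auto simp: box_on_def coord_space_def floor_on_def divide_inverse_commute)
qed

lemma card_lattice_box_on: "card (lattice \<inter> box_on J (real k)) = k ^ card J"
proof -
  have "bij_betw (\<lambda>f. \<chi> i. if i \<in> J then real (f i) else 0) (PiE J (\<lambda>_. {..<k}))
          (lattice \<inter> box_on J (real k))"
  proof (rule bij_betwI')
    fix f g :: "'a \<Rightarrow> nat"
    assume fg: "f \<in> PiE J (\<lambda>_. {..<k})" "g \<in> PiE J (\<lambda>_. {..<k})"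
    show "((\<chi> i. if i \<in> J then real (f i) else 0) = (\<chi> i. if i \<in> J then real (g i) else 0)) = (f = g)"
      using fg by (auto simp: vec_eq_iff intro: PiE_ext[OF fg])
  next
    fix f :: "'a \<Rightarrow> nat" assume "f \<in> PiE J (\<lambda>_. {..<k})"
    then show "(\<chi> i. if i \<in> J then real (f i) else 0) \<in> lattice \<inter> box_on J (real k)"
      by (auto simp: lattice_def box_on_def coord_space_def)
  next
    fix x :: "real ^ 'a" assume x: "x \<in> lattice \<inter> box_on J (real k)"
    define f where "f = restrict (\<lambda>i. nat \<lfloor>x $ i\<rfloor>) J"
    have *: "real (f i) = x $ i" if "i \<in> J" for i
    proof -
      from x obtain m where "x $ i = of_int m" by (auto simp: lattice_def elim: Ints_cases)
      with x that show ?thesis by (auto simp: box_on_def f_def)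
    qed
    have "f i < k" if "i \<in> J" for i
      using *[OF that] x that by (auto simp: box_on_def)
    then have "f \<in> PiE J (\<lambda>_. {..<k})" by (auto simp: f_def)
    moreover have "x = (\<chi> i. if i \<in> J then real (f i) else 0)"
      using x * by (auto simp: vec_eq_iff box_on_def coord_space_def)
    ultimately show "\<exists>f\<in>PiE J (\<lambda>_. {..<k}). x = (\<chi> i. if i \<in> J then real (f i) else 0)" by blast
  qed
  then show ?thesis by (simp add: bij_betw_same_card[symmetric] card_PiE)
qed

text \<open>A point of the k-box splits uniquely into its coordinatewise floor, one of k^|J| integer
  points, and a fractional part, which stays in G because G contains the integer points of
  \<open>coord_space J\<close>.\<close>

lemma card_box_on_scale:
  assumes diff: "\<And>x y. x \<in> G \<Longrightarrow> y \<in> G \<Longrightarrow> x - y \<in> G" and sub: "lattice \<inter> coord_space J \<subseteq> G"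
  shows "card (G \<inter> box_on J (real k)) = k ^ card J * card (G \<inter> box_on J 1)"
proof -
  have G0: "0 \<in> G" using sub by (auto simp: lattice_def coord_space_def)
  have add: "x + y \<in> G" if "x \<in> G" "y \<in> G" for x y
    using diff[of x "0 - y"] diff[OF G0, of y] that by simp
  have cs: "box_on J M \<subseteq> coord_space J" for M by (auto simp: box_on_def)
  have "bij_betw (\<lambda>(u, x). x + u) ((lattice \<inter> box_on J (real k)) \<times> (G \<inter> box_on J 1))
          (G \<inter> box_on J (real k))"
  proof (rule bij_betwI')
    fix a b assume "a \<in> (lattice \<inter> box_on J (real k)) \<times> (G \<inter> box_on J 1)"
      "b \<in> (lattice \<inter> box_on J (real k)) \<times> (G \<inter> box_on J 1)"
    moreover obtain u x where a: "a = (u, x)" by fastforce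
    moreover obtain u' x' where b: "b = (u', x')" by fastforce
    ultimately have *: "u \<in> lattice" "u' \<in> lattice" "x \<in> box_on J 1" "x' \<in> box_on J 1" by auto
    show "((case a of (u, x) \<Rightarrow> x + u) = (case b of (u, x) \<Rightarrow> x + u)) = (a = b)"
    proof
      assume "(case a of (u, x) \<Rightarrow> x + u) = (case b of (u, x) \<Rightarrow> x + u)"
      then have eq: "x - x' = 1 *\<^sub>R (u' - u)" by (simp add: a b algebra_simps)
      then have "x = x'"
        using * box_on_congruent_eq[of x J 1 x' "u' - u"] by (auto intro: lattice_diff)
      with eq show "a = b" by (simp add: a b)
    qed auto
  next
    fix a assume a: "a \<in> (lattice \<inter> box_on J (real k)) \<times> (G \<inter> box_on J 1)"
    then obtain u x where ux: "a = (u, x)" "u \<in> lattice" "u \<in> box_on J (real k)" "x \<in> G" "x \<in> box_on J 1"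
      by auto
    have "x + u \<in> G" using ux sub cs by (intro add) auto
    moreover have "x $ i + u $ i < real k" "0 \<le> x $ i + u $ i" if "i \<in> J" for i
    proof -
      obtain m where "u $ i = of_int m" using ux by (auto simp: lattice_def elim: Ints_cases)
      moreover have "0 \<le> u $ i" "u $ i < real k" "0 \<le> x $ i" "x $ i < 1"
        using ux that by (auto simp: box_on_def)
      \<comment> \<open>An integer below k is at most k - 1, which leaves room for the fractional
        part.\<close>
      ultimately have "m + 1 \<le> int k" by linarith
      then have "u $ i + 1 \<le> real k" using \<open>u $ i = of_int m\<close> by linarith
      then show "x $ i + u $ i < real k" "0 \<le> x $ i + u $ i"
        using \<open>0 \<le> u $ i\<close> \<open>0 \<le> x $ i\<close> \<open>x $ i < 1\<close> by linarith+
    qed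
    ultimately show "(case a of (u, x) \<Rightarrow> x + u) \<in> G \<inter> box_on J (real k)"
      using ux by (auto simp: box_on_def coord_space_def)
  next
    fix y assume y: "y \<in> G \<inter> box_on J (real k)"
    let ?u = "floor_on J y"
    have "y - ?u \<in> G" using y sub floor_on_in_lattice[of J y] by (intro diff) auto
    moreover have "y - ?u \<in> box_on J 1"
      using reduce_into_box_on[of y J 1] y cs by auto
    moreover have "?u \<in> box_on J (real k)"
    proof -
      have "of_int \<lfloor>y $ i\<rfloor> < real k" if "i \<in> J" for i
        using y that by (auto simp: box_on_def intro: le_less_trans[OF of_int_floor_le])
      then show ?thesis using y by (auto simp: box_on_def coord_space_def floor_on_def)
    qed
    ultimately show "\<exists>a\<in>(lattice \<inter> box_on J (real k)) \<times> (G \<inter> box_on J 1). y = (case a of (u, x) \<Rightarrow> x + u)"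
      using floor_on_in_lattice[of J y] by (intro bexI[of _ "(?u, y - ?u)"]) auto
  qed
  then have "card (G \<inter> box_on J (real k))
      = card (lattice \<inter> box_on J (real k)) * card (G \<inter> box_on J 1)"
    by (simp add: bij_betw_same_card[symmetric] card_cartesian_product)
  then show ?thesis by (simp add: card_lattice_box_on)
qed

section \<open>A discrete form of Minkowski's second theorem for the cube\<close>

text \<open>
  Minkowski's argument without volumes: \<open>\<Gamma> = range pt\<close> is a finer lattice with a basis \<open>c\<close> adapted to the
  minima. On the points of \<open>\<Gamma>\<close> in a large cube, \<open>\<Phi>(q) = \<Sum>\<^sub>m (l\<^sub>m - l\<^bsub>m-1\<^esub>) q\<^sub>m\<close> with \<open>l\<^sub>m = \<lfloor>N \<mu>\<^sub>m\<rfloor>\<close>, where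
  \<open>q\<^sub>m\<close> is a point of the cube chosen arbitrarily in the coset \<open>q + span (c\<^sub>0, \<dots>, c\<^bsub>m-1\<^esub>)\<close>. In the basis
  \<open>c\<close>, the map \<open>\<Phi>\<close> is triangular with diagonal \<open>l\<close>, which leaves room for \<open>\<Prod> l\<^sub>m\<close> offsets, and a difference
  with leading coordinate \<open>k\<close> has norm less than \<open>l\<^sub>k N\<close>; hence the points obtained are distinct
  modulo \<open>N\<^sup>2 L\<close>. Counting them as \<open>N \<rightarrow> \<infinity>\<close> gives the theorem.
\<close>

locale adapted_basis =
  fixes L :: "(real ^ 'n) set" and J :: "'n set" and c :: "nat \<Rightarrow> real ^ 'n" and \<mu> :: "nat \<Rightarrow> real"
    and d :: nat and pt :: "(nat \<Rightarrow> int) \<Rightarrow> real ^ 'n"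
  defines "d \<equiv> card J" and "pt \<equiv> \<lambda>z. \<Sum>m<d. of_int (z m) *\<^sub>R c m"
  assumes lattice_sub: "lattice \<inter> coord_space J \<subseteq> L"
    and L_diff: "\<And>x y. x \<in> L \<Longrightarrow> y \<in> L \<Longrightarrow> x - y \<in> L"
    and c_in: "\<And>m. m < d \<Longrightarrow> c m \<in> coord_space J"
    and indep: "\<And>z m. pt z = 0 \<Longrightarrow> m < d \<Longrightarrow> z m = 0"
    and L_sub: "L \<inter> coord_space J \<subseteq> range pt"
    and finite_box: "finite (range pt \<inter> box_on J 1)"
    and mu_mono: "\<And>i j. i \<le> j \<Longrightarrow> j < d \<Longrightarrow> \<mu> i \<le> \<mu> j"
    and mu_pos: "\<And>m. m < d \<Longrightarrow> 0 < \<mu> m"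
    and minimal: "\<And>z m. pt z \<in> L \<Longrightarrow> m < d \<Longrightarrow> infnorm (pt z) < \<mu> m \<Longrightarrow> z m = 0"
begin

lemma pt_diff: "pt (\<lambda>m. z m - z' m) = pt z - pt z'"
  by (simp add: pt_def algebra_simps sum_subtractf)

lemma pt_cong: "(\<And>m. m < d \<Longrightarrow> z m = z' m) \<Longrightarrow> pt z = pt z'"
  by (auto simp: pt_def)

lemma pt_scale: "pt (\<lambda>m. a * z m) = of_int a *\<^sub>R pt z"
  by (simp add: pt_def scaleR_sum_right)

lemma pt_in: "pt z \<in> coord_space J"
  unfolding pt_def by (intro subspace_sum subspace_coord_space subspace_scale c_in) auto

lemma pt_eqD:
  assumes "pt z = pt z'" "m < d"
  shows "z m = z' m"
  using indep[of "\<lambda>m. z m - z' m" m] assms by (simp add: pt_diff)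

lemma range_pt_diff: "x \<in> range pt \<Longrightarrow> y \<in> range pt \<Longrightarrow> x - y \<in> range pt"
  by (auto simp: pt_diff[symmetric])

lemma card_range_pt_box:
  "card (range pt \<inter> box_on J (real k)) = k ^ d * card (range pt \<inter> box_on J 1)"
proof -
  have "lattice \<inter> coord_space J \<subseteq> range pt" using L_sub lattice_sub by blast
  then show ?thesis unfolding d_def by (intro card_box_on_scale range_pt_diff)
qed

lemma card_range_pt_box_pos: "card (range pt \<inter> box_on J 1) > 0"
proof -
  have "pt (\<lambda>_. 0) = 0" by (simp add: pt_def)
  then have "0 \<in> range pt" by (metis rangeI)
  moreover have "0 \<in> box_on J 1" by (auto simp: box_on_def coord_space_def)
  ultimately show ?thesis using finite_box by (auto simp: card_gt_0_iff)
qed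

section \<open>The triangular map \<Phi> at a fixed scale N\<close>

context
  fixes N C :: nat
  assumes C: "(\<Sum>m<d. infnorm (c m)) < real C" and NC: "C < N"
    and N: "\<And>m. m < d \<Longrightarrow> 1 \<le> real N * \<mu> m"
begin

text \<open>\<open>step m\<close> is \<open>l\<^sub>m\<close> in the outline of this section and
  \<open>weight m\<close> its increment. In coordinates, \<open>select m z\<close> stands for
  \<open>q\<^sub>m\<close>, and \<open>shear z e\<close> for \<Phi>(q) moved by the offset
  e.\<close>

definition step :: "nat \<Rightarrow> int" where
  "step m = \<lfloor>real N * \<mu> m\<rfloor>"

definition weight :: "nat \<Rightarrow> int" where
  "weight m = step m - (if m = 0 then 0 else step (m - 1))"

text \<open>The side is N - C instead of N because the offsets later contribute up to
  \<open>step k * C\<close> to a norm that must stay below \<open>step k * N\<close>.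
  \<open>PiE\<close> fixes the values outside \<open>{..<d}\<close>, so that a point determines its
  coefficients.\<close>

definition coeffs :: "(nat \<Rightarrow> int) set" where
  "coeffs = {z \<in> PiE {..<d} (\<lambda>_. UNIV). pt z \<in> box_on J (real (N - C))}"

text \<open>The choice sees only the coordinates from m on, so points in one coset of the span of
  the first m basis vectors receive the same representative.\<close>

definition select :: "nat \<Rightarrow> (nat \<Rightarrow> int) \<Rightarrow> nat \<Rightarrow> int" where
  "select m z = (SOME z'. z' \<in> coeffs \<and> (\<forall>r\<in>{m..<d}. z' r = z r))"

definition offsets :: "(nat \<Rightarrow> int) set" where
  "offsets = PiE {..<d} (\<lambda>m. {0..<step m})"

definition shear :: "(nat \<Rightarrow> int) \<Rightarrow> (nat \<Rightarrow> int) \<Rightarrow> nat \<Rightarrow> int" where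
  "shear z e r = (\<Sum>m<d. weight m * select m z r) + e r"

lemma offsetsD:
  assumes "e \<in> offsets" "m < d"
  shows "0 \<le> e m" "e m < step m"
  using PiE_mem[of e "{..<d}" "\<lambda>m. {0..<step m}" m] assms by (simp_all add: offsets_def)

lemma step_pos: "m < d \<Longrightarrow> 0 < step m"
  using N[of m] by (simp add: step_def)

lemma step_mono: "i \<le> j \<Longrightarrow> j < d \<Longrightarrow> step i \<le> step j"
  unfolding step_def by (intro floor_mono mult_left_mono mu_mono) auto

lemma weight_nonneg: "m < d \<Longrightarrow> 0 \<le> weight m"
  using step_mono[of "m - 1" m] step_pos[of m] by (auto simp: weight_def)

lemma sum_weight: "(\<Sum>m\<le>k. weight m) = step k"
  by (induction k) (auto simp: weight_def)

lemma select:
  assumes "z \<in> coeffs"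
  shows "select m z \<in> coeffs" "\<And>r. r \<in> {m..<d} \<Longrightarrow> select m z r = z r"
proof -
  have "select m z \<in> coeffs \<and> (\<forall>r\<in>{m..<d}. select m z r = z r)"
    unfolding select_def by (rule someI[of _ z]) (use assms in auto)
  then show "select m z \<in> coeffs" "\<And>r. r \<in> {m..<d} \<Longrightarrow> select m z r = z r" by auto
qed

lemma select_cong: "(\<And>r. r \<in> {m..<d} \<Longrightarrow> z r = z' r) \<Longrightarrow> select m z = select m z'"
  unfolding select_def by (intro arg_cong[where f = Eps] ext) auto

text \<open>For m \<le> r, \<open>select m z\<close> keeps coordinate r, and the weights up to r
  telescope to \<open>step r\<close>. The remaining sum depends only on coordinates of z after r:
  this is the triangular form with diagonal \<open>step\<close>.\<close>

lemma shear_split: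
  assumes "z \<in> coeffs" "r < d"
  shows "shear z e r = step r * z r + (\<Sum>m\<in>{r<..<d}. weight m * select m z r) + e r"
proof -
  have split: "{..<d} = {..r} \<union> {r<..<d}" using assms by auto
  have "(\<Sum>m<d. weight m * select m z r)
      = (\<Sum>m\<le>r. weight m * select m z r) + (\<Sum>m\<in>{r<..<d}. weight m * select m z r)"
    unfolding split by (intro sum.union_disjoint) auto
  also have "(\<Sum>m\<le>r. weight m * select m z r) = (\<Sum>m\<le>r. weight m) * z r"
    unfolding sum_distrib_right using assms by (intro sum.cong) (auto simp: select)
  finally show ?thesis by (simp add: shear_def sum_weight)
qed

text \<open>Descending recovery: once the coordinates after r agree, so do the selected terms, and
  \<open>z r\<close> and \<open>e r\<close> are the quotient and the remainder of what is left on
  division by \<open>step r\<close>.\<close>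

lemma shear_eqD:
  assumes z: "z \<in> coeffs" "z' \<in> coeffs" and e: "e \<in> offsets" "e' \<in> offsets"
    and eq: "\<And>r. k \<le> r \<Longrightarrow> r < d \<Longrightarrow> shear z e r = shear z' e' r"
  shows "k \<le> r \<Longrightarrow> r < d \<Longrightarrow> z r = z' r \<and> e r = e' r"
proof (induction "d - r" arbitrary: r rule: less_induct)
  case less
  have "z s = z' s" if "s \<in> {r<..<d}" for s
    using less.hyps[of s] less.prems that by force
  then have "select m z = select m z'" if "m \<in> {r<..<d}" for m
    using that by (intro select_cong) auto
  then have "(\<Sum>m\<in>{r<..<d}. weight m * select m z r) = (\<Sum>m\<in>{r<..<d}. weight m * select m z' r)"
    by (intro sum.cong) auto
  then have *: "e r + step r * z r = e' r + step r * z' r"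
    using eq[OF less.prems] shear_split[OF z(1) less.prems(2), of e]
      shear_split[OF z(2) less.prems(2), of e'] by linarith
  have "0 \<le> e r" "e r < step r" "0 \<le> e' r" "e' r < step r"
    using offsetsD[OF e(1) less.prems(2)] offsetsD[OF e(2) less.prems(2)] by auto
  then have "(e r + step r * z r) div step r = z r" "(e' r + step r * z' r) div step r = z' r"
    by simp_all
  then have "z r = z' r" using * by metis
  with * show ?case by simp
qed

lemma pt_shear: "pt (shear z e) = (\<Sum>m<d. of_int (weight m) *\<^sub>R pt (select m z)) + pt e"
proof -
  have "(\<Sum>m<d. of_int (weight m) *\<^sub>R pt (select m z))
      = (\<Sum>r<d. of_int (\<Sum>m<d. weight m * select m z r) *\<^sub>R c r)"
    unfolding pt_def scaleR_sum_right by (subst sum.swap) (simp add: scaleR_sum_left)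
  then show ?thesis by (simp add: pt_def shear_def algebra_simps sum.distrib)
qed

text \<open>Agreement after k makes the selections for m > k cancel. The other weights sum to
  \<open>step k\<close> and multiply differences inside a box of side N - C. Offsets agree after k
  and differ by at most \<open>step k\<close> up to k, which adds less than
  \<open>step k * C\<close>.\<close>

lemma infnorm_shear_diff:
  assumes z: "z \<in> coeffs" "z' \<in> coeffs" and e: "e \<in> offsets" "e' \<in> offsets" and k: "k < d"
    and eq: "\<And>r. k < r \<Longrightarrow> r < d \<Longrightarrow> shear z e r = shear z' e' r"
  shows "infnorm (pt (shear z e) - pt (shear z' e')) < real_of_int (step k) * real N"
proof -
  have top: "z r = z' r \<and> e r = e' r" if "k < r" "r < d" for r
    using shear_eqD[OF z e, of "Suc k" r] eq that by auto
  have sel: "select m z = select m z'" if "k < m" for m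
    using that top by (intro select_cong) auto
  have "infnorm (\<Sum>m<d. of_int (weight m) *\<^sub>R (pt (select m z) - pt (select m z')))
      = infnorm (\<Sum>m\<le>k. of_int (weight m) *\<^sub>R (pt (select m z) - pt (select m z')))"
    by (intro arg_cong[where f = infnorm] sum.mono_neutral_right) (use k sel in auto)
  also have "\<dots> \<le> (\<Sum>m\<le>k. of_int (weight m) * real (N - C))"
  proof (rule order_trans[OF infnorm_sum_le], rule sum_mono)
    fix m assume "m \<in> {..k}"
    then have m: "m < d" using k by auto
    have "infnorm (pt (select m z) - pt (select m z')) < real (N - C)"
      using select(1)[OF z(1), of m] select(1)[OF z(2), of m] NC
      by (intro box_on_diff_less[where J = J]) (auto simp: coeffs_def)
    then show "infnorm (of_int (weight m) *\<^sub>R (pt (select m z) - pt (select m z')))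
        \<le> of_int (weight m) * real (N - C)"
      using weight_nonneg[OF m] by (simp add: infnorm_mul mult_left_mono)
  qed
  also have "\<dots> = real_of_int (step k) * real (N - C)"
    by (simp add: sum_distrib_right[symmetric] sum_weight[symmetric])
  finally have 1: "infnorm (\<Sum>m<d. of_int (weight m) *\<^sub>R (pt (select m z) - pt (select m z')))
    \<le> real_of_int (step k) * real (N - C)" .
  have "infnorm (pt e - pt e') \<le> (\<Sum>m<d. infnorm (of_int (e m - e' m) *\<^sub>R c m))"
    unfolding pt_diff[symmetric] unfolding pt_def by (rule infnorm_sum_le)
  also have "\<dots> \<le> (\<Sum>m<d. of_int (step k) * infnorm (c m))"
  proof (rule sum_mono)
    fix m assume "m \<in> {..<d}"
    then have m: "m < d" by simp
    have "\<bar>e m - e' m\<bar> \<le> step k"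
    proof (cases "k < m")
      case True
      then show ?thesis using top[OF True m] step_pos[OF k] by simp
    next
      case False
      then have "step m \<le> step k" using k by (intro step_mono) auto
      moreover have "0 \<le> e m" "e m < step m" "0 \<le> e' m" "e' m < step m"
        using offsetsD[OF e(1) m] offsetsD[OF e(2) m] by auto
      ultimately show ?thesis by linarith
    qed
    then have "\<bar>real_of_int (e m - e' m)\<bar> \<le> of_int (step k)" by linarith
    then show "infnorm (of_int (e m - e' m) *\<^sub>R c m) \<le> of_int (step k) * infnorm (c m)"
      by (simp only: infnorm_mul) (intro mult_right_mono infnorm_pos_le)
  qed
  also have "\<dots> < of_int (step k) * real C"
    unfolding sum_distrib_left[symmetric] using C step_pos[OF k] by simp
  finally have 2: "infnorm (pt e - pt e') < of_int (step k) * real C" .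
  have "pt (shear z e) - pt (shear z' e')
      = (\<Sum>m<d. of_int (weight m) *\<^sub>R (pt (select m z) - pt (select m z'))) + (pt e - pt e')"
    by (simp add: pt_shear scaleR_diff_right sum_subtractf)
  then have "infnorm (pt (shear z e) - pt (shear z' e'))
      < real_of_int (step k) * real (N - C) + of_int (step k) * real C"
    using 1 2 infnorm_triangle[of "\<Sum>m<d. of_int (weight m) *\<^sub>R (pt (select m z) - pt (select m z'))"
        "pt e - pt e'"] by simp
  also have "\<dots> = real_of_int (step k) * real N"
    using NC by (simp add: of_nat_diff algebra_simps)
  finally show ?thesis .
qed

text \<open>If w is nonzero, let k be its last nonzero coordinate in the basis c. Then the two
  sheared points agree after k, and the norm estimate gives \<open>infnorm w < \<mu> k\<close>,
  against \<open>minimal\<close>. Hence w is 0 and \<open>shear_eqD\<close> applies to all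
  coordinates.\<close>

lemma shear_inj_mod:
  assumes z: "z \<in> coeffs" "z' \<in> coeffs" and e: "e \<in> offsets" "e' \<in> offsets"
    and w: "w \<in> L \<inter> coord_space J"
    and eq: "pt (shear z e) - pt (shear z' e') = real (N * N) *\<^sub>R w"
  shows "z = z'" "e = e'"
proof -
  obtain y where y: "w = pt y" using w L_sub by auto
  have "pt (\<lambda>r. shear z e r - shear z' e' r) = pt (\<lambda>r. int (N * N) * y r)"
    using eq by (simp only: pt_diff pt_scale y of_int_of_nat_eq)
  from pt_eqD[OF this] have coord: "shear z e r - shear z' e' r = int (N * N) * y r" if "r < d" for r
    using that by simp
  have y0: "y r = 0" if "r < d" for r
  proof (rule ccontr)
    assume "y r \<noteq> 0"
    define k where "k = Max {r. r < d \<and> y r \<noteq> 0}"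
    have "k \<in> {r. r < d \<and> y r \<noteq> 0}" unfolding k_def
      using \<open>y r \<noteq> 0\<close> that by (intro Max_in) auto
    then have k: "k < d" "y k \<noteq> 0" by auto
    have "y r = 0" if "k < r" "r < d" for r
    proof (rule ccontr)
      assume "y r \<noteq> 0"
      then have "r \<le> k" unfolding k_def using that by (intro Max_ge) auto
      with \<open>k < r\<close> show False by simp
    qed
    then have "infnorm (real (N * N) *\<^sub>R w) < real_of_int (step k) * real N"
      unfolding eq[symmetric] using coord by (intro infnorm_shear_diff z e k) force
    \<comment> \<open>One factor N comes from \<open>step k\<close>, the other from the side of the
      cube; hence the modulus \<open>N * N\<close>.\<close>
    also have "\<dots> \<le> (real N * \<mu> k) * real N"
      unfolding step_def by (intro mult_right_mono) auto
    finally have "infnorm w < \<mu> k" using NC by (simp add: infnorm_mul)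
    then show False using minimal[of y k] k w y by auto
  qed
  have *: "z r = z' r \<and> e r = e' r" if "r < d" for r
    using shear_eqD[OF z e, of 0 r] coord y0 that by simp
  show "z = z'"
    using z * by (intro PiE_ext[of z "{..<d}" "\<lambda>_. UNIV" z']) (auto simp: coeffs_def)
  show "e = e'"
    using e * unfolding offsets_def by (intro PiE_ext[of e "{..<d}" _ e']) auto
qed

lemma card_coeffs: "card coeffs = (N - C) ^ d * card (range pt \<inter> box_on J 1)"
proof -
  have "bij_betw pt coeffs (range pt \<inter> box_on J (real (N - C)))"
  proof (rule bij_betwI')
    fix z z' assume "z \<in> coeffs" "z' \<in> coeffs"
    then show "(pt z = pt z') = (z = z')"
      using PiE_ext[of z "{..<d}" "\<lambda>_. UNIV" z'] pt_eqD[of z z'] by (auto simp: coeffs_def)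
  next
    fix x assume x: "x \<in> range pt \<inter> box_on J (real (N - C))"
    then obtain z where "x = pt z" by auto
    then have "x = pt (restrict z {..<d})" by (auto intro: pt_cong)
    then show "\<exists>z\<in>coeffs. x = pt z"
      using x by (intro bexI[of _ "restrict z {..<d}"]) (auto simp: coeffs_def)
  qed (auto simp: coeffs_def)
  then show ?thesis by (simp only: bij_betw_same_card card_range_pt_box)
qed

lemma card_offsets: "real (card offsets) = (\<Prod>m<d. of_int (step m))"
  using step_pos by (auto simp: offsets_def card_PiE less_imp_le intro!: prod.cong)

text \<open>The points \<open>pt (shear z e)\<close> are distinct modulo N^2 times the part of L in
  \<open>coord_space J\<close>, and the w in \<open>L \<inter> box_on J 1\<close> represent that
  part modulo its integer points. So the sums with N^2 w remain distinct after reduction into the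
  box of side N^2. The number of points of \<open>range pt\<close> in the unit box occurs on both
  sides and cancels.\<close>

lemma discrete_bound:
  "real (N - C) ^ d * (\<Prod>m<d. of_int (step m)) * real (card (L \<inter> box_on J 1)) \<le> (real N * real N) ^ d"
proof -
  let ?R = "real (N * N)" and ?g = "card (range pt \<inter> box_on J 1)"
  have R: "?R > 0" using NC by simp
  \<comment> \<open>A positive \<open>card\<close> certifies finiteness, since infinite sets have
    \<open>card\<close> 0.\<close>
  have finite_target: "finite (range pt \<inter> box_on J ?R)"
    using card_range_pt_box[of "N * N"] card_range_pt_box_pos NC by (intro card_ge_0_finite) simp
  define f where "f = (\<lambda>((z, e), w). let x = pt (shear z e) + ?R *\<^sub>R w in
    x - ?R *\<^sub>R floor_on J (x /\<^sub>R ?R))"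
  have scale_in: "?R *\<^sub>R w \<in> range pt" if w: "w \<in> L \<inter> coord_space J" for w
  proof -
    obtain y where "w = pt y" using w L_sub by auto
    then have "?R *\<^sub>R w = pt (\<lambda>m. int (N * N) * y m)" by (simp only: pt_scale of_int_of_nat_eq)
    then show ?thesis by simp
  qed
  have add_in: "x + y \<in> range pt" if "x \<in> range pt" "y \<in> range pt" for x y
    using range_pt_diff[OF that(1) range_pt_diff[OF _ that(2)], of 0]
    by (force simp: pt_def intro: image_eqI[of _ _ "\<lambda>_. 0"])
  have box_sub: "box_on J 1 \<subseteq> coord_space J" by (auto simp: box_on_def)
  have into: "f \<in> (coeffs \<times> offsets) \<times> (L \<inter> box_on J 1) \<rightarrow> range pt \<inter> box_on J ?R"
  proof
    fix s assume "s \<in> (coeffs \<times> offsets) \<times> (L \<inter> box_on J 1)"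
    then obtain z e w where s: "s = ((z, e), w)" "w \<in> L \<inter> coord_space J" using box_sub by fastforce
    define x where "x = pt (shear z e) + ?R *\<^sub>R w"
    have "x \<in> range pt" unfolding x_def using s by (intro add_in scale_in) auto
    moreover have "?R *\<^sub>R floor_on J (x /\<^sub>R ?R) \<in> range pt"
      using floor_on_in_lattice lattice_sub by (intro scale_in) blast
    moreover from calculation(1) have "x \<in> coord_space J" using pt_in by auto
    ultimately show "f s \<in> range pt \<inter> box_on J ?R"
      using reduce_into_box_on[OF _ R] range_pt_diff by (simp add: f_def s x_def Let_def)
  qed
  have inj: "inj_on f ((coeffs \<times> offsets) \<times> (L \<inter> box_on J 1))"
  proof (rule inj_onI)
    fix s s'
    assume "s \<in> (coeffs \<times> offsets) \<times> (L \<inter> box_on J 1)" "s' \<in> (coeffs \<times> offsets) \<times> (L \<inter> box_on J 1)"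
    then obtain z e w z' e' w' where s: "s = ((z, e), w)" "s' = ((z', e'), w')"
      and z: "z \<in> coeffs" "z' \<in> coeffs" and e: "e \<in> offsets" "e' \<in> offsets"
      and w: "w \<in> L" "w' \<in> L" "w \<in> box_on J 1" "w' \<in> box_on J 1" by fastforce
    assume feq: "f s = f s'"
    define x where "x = pt (shear z e) + ?R *\<^sub>R w"
    define x' where "x' = pt (shear z' e') + ?R *\<^sub>R w'"
    define u where "u = floor_on J (x /\<^sub>R ?R) - floor_on J (x' /\<^sub>R ?R)"
    have u: "u \<in> lattice" "u \<in> coord_space J"
      unfolding u_def using floor_on_in_lattice subspace_coord_space
      by (blast intro: lattice_diff subspace_diff)+
    have "x - x' = ?R *\<^sub>R u"
      using feq by (simp add: f_def s Let_def x_def x'_def u_def algebra_simps)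
    then have eq: "pt (shear z e) - pt (shear z' e') = ?R *\<^sub>R (u - (w - w'))"
      by (simp add: x_def x'_def algebra_simps)
    have "u - (w - w') \<in> L \<inter> coord_space J"
      using u w lattice_sub box_sub subspace_coord_space by (blast intro: L_diff subspace_diff)
    from shear_inj_mod[OF z e this eq] have "z = z'" "e = e'" by auto
    with eq R have "w - w' = 1 *\<^sub>R u" by auto
    then have "w = w'" using box_on_congruent_eq[OF w(3,4)] u by auto
    with \<open>z = z'\<close> \<open>e = e'\<close> show "s = s'" by (simp add: s)
  qed
  have "card ((coeffs \<times> offsets) \<times> (L \<inter> box_on J 1)) \<le> card (range pt \<inter> box_on J ?R)"
    by (rule card_inj_on_le[OF inj _ finite_target]) (use into in auto)
  then have "card coeffs * card offsets * card (L \<inter> box_on J 1) \<le> (N * N) ^ d * ?g"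
    by (simp only: card_cartesian_product card_range_pt_box)
  then have "real (card coeffs * card offsets * card (L \<inter> box_on J 1)) \<le> real ((N * N) ^ d * ?g)"
    by (rule of_nat_mono)
  then have "(real (N - C) ^ d * (\<Prod>m<d. of_int (step m)) * real (card (L \<inter> box_on J 1))) * real ?g
      \<le> (real N * real N) ^ d * real ?g"
    by (simp only: of_nat_mult of_nat_power card_offsets card_coeffs mult_ac)
  then show ?thesis using card_range_pt_box_pos by (simp only: mult_le_cancel_right of_nat_0_less_iff)
qed

end

text \<open>Divide \<open>discrete_bound\<close> by N^(2d) and let N grow with C fixed: (N - C)/N
  tends to 1 and \<open>step m\<close> / N to \<open>\<mu> m\<close>.\<close>

lemma card_mult_prod_le_1: "real (card (L \<inter> box_on J 1)) * (\<Prod>m<d. \<mu> m) \<le> 1"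
proof -
  obtain C :: nat where C: "(\<Sum>m<d. infnorm (c m)) < real C" using reals_Archimedean2 by blast
  let ?h = "real (card (L \<inter> box_on J 1))"
  have ev: "eventually (\<lambda>N. 1 \<le> real N * \<mu> m) sequentially" if "m < d" for m
    using eventually_ge_at_top[of "nat \<lceil>1 / \<mu> m\<rceil>"]
  proof eventually_elim
    case (elim N)
    then have "1 / \<mu> m \<le> real N" by linarith
    then show ?case using mu_pos[OF that] by (simp add: pos_divide_le_eq)
  qed
  have "eventually (\<lambda>N. \<forall>m\<in>{..<d}. 1 \<le> real N * \<mu> m) sequentially"
    by (rule eventually_ball_finite) (use ev in auto)
  then have "eventually (\<lambda>N. (1 - real C / real N) ^ d * (\<Prod>m<d. of_int \<lfloor>real N * \<mu> m\<rfloor> / real N) * ?h \<le> 1)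
    sequentially"
    using eventually_gt_at_top[of C]
  proof eventually_elim
    case (elim N)
    have N: "real N > 0" using elim by simp
    have "real (N - C) ^ d * (\<Prod>m<d. of_int \<lfloor>real N * \<mu> m\<rfloor>) * ?h \<le> (real N * real N) ^ d"
      using discrete_bound[OF C, of N] elim by (simp add: step_def[OF C])
    then have "((real (N - C)) ^ d * (\<Prod>m<d. of_int \<lfloor>real N * \<mu> m\<rfloor>) * ?h) / (real N * real N) ^ d \<le> 1"
      using N by simp
    also have "((real (N - C)) ^ d * (\<Prod>m<d. of_int \<lfloor>real N * \<mu> m\<rfloor>) * ?h) / (real N * real N) ^ d
        = (real (N - C) / real N) ^ d * ((\<Prod>m<d. of_int \<lfloor>real N * \<mu> m\<rfloor>) / real N ^ d) * ?h"
      by (simp add: power_divide power_mult_distrib)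
    also have "real (N - C) / real N = 1 - real C / real N"
      using elim N by (simp add: of_nat_diff diff_divide_distrib)
    also have "(\<Prod>m<d. of_int \<lfloor>real N * \<mu> m\<rfloor>) / real N ^ d = (\<Prod>m<d. of_int \<lfloor>real N * \<mu> m\<rfloor> / real N)"
      by (simp add: prod_dividef)
    finally show ?case .
  qed
  moreover have "(\<lambda>N. (1 - real C / real N) ^ d * (\<Prod>m<d. of_int \<lfloor>real N * \<mu> m\<rfloor> / real N) * ?h)
      \<longlonglongrightarrow> 1 ^ d * (\<Prod>m<d. \<mu> m) * ?h"
  proof (intro tendsto_mult tendsto_power tendsto_prod tendsto_const)
    show "(\<lambda>N. 1 - real C / real N) \<longlonglongrightarrow> 1"
      using tendsto_diff[OF tendsto_const lim_const_over_n[of "real C"], of 1] by simp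
    show "(\<lambda>N. of_int \<lfloor>real N * \<mu> m\<rfloor> / real N) \<longlonglongrightarrow> \<mu> m" for m
    proof (rule tendsto_sandwich)
      show "(\<lambda>N. \<mu> m - 1 / real N) \<longlonglongrightarrow> \<mu> m"
        using tendsto_diff[OF tendsto_const lim_const_over_n[of "1 :: real"], of "\<mu> m"] by simp
      show "eventually (\<lambda>N. \<mu> m - 1 / real N \<le> of_int \<lfloor>real N * \<mu> m\<rfloor> / real N) sequentially"
        "eventually (\<lambda>N. of_int \<lfloor>real N * \<mu> m\<rfloor> / real N \<le> \<mu> m) sequentially"
        unfolding atomize_conj eventually_conj_iff[symmetric]
        using eventually_gt_at_top[of 0]
      proof eventually_elim
        case (elim N)
        have "\<mu> m - 1 / real N = (real N * \<mu> m - 1) / real N"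
          using elim by (simp add: diff_divide_distrib)
        also have "\<dots> \<le> of_int \<lfloor>real N * \<mu> m\<rfloor> / real N"
          by (intro divide_right_mono) linarith+
        finally have 1: "\<mu> m - 1 / real N \<le> of_int \<lfloor>real N * \<mu> m\<rfloor> / real N" .
        have "of_int \<lfloor>real N * \<mu> m\<rfloor> \<le> real N * \<mu> m" by linarith
        then have "of_int \<lfloor>real N * \<mu> m\<rfloor> / real N \<le> \<mu> m"
          using elim by (simp add: field_simps)
        with 1 show "\<mu> m - 1 / real N \<le> of_int \<lfloor>real N * \<mu> m\<rfloor> / real N \<and> of_int \<lfloor>real N * \<mu> m\<rfloor> / real N \<le> \<mu> m" ..
      qed
    qed simp
  qed
  ultimately show ?thesis
    by (auto dest: tendsto_upperbound simp: mult.commute)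
qed

end

section \<open>Lattices containing the integer lattice\<close>

lemma coord_space_subset_span:
  assumes "\<And>j. j \<in> J \<Longrightarrow> axis j 1 \<in> span S"
  shows "coord_space J \<subseteq> span S"
proof
  fix x :: "real ^ 'a" assume x: "x \<in> coord_space J"
  have "x $ j *\<^sub>R axis j 1 \<in> span S" for j
    using x assms[of j] by (cases "j \<in> J") (auto simp: coord_space_def span_scale span_0)
  then have "(\<Sum>j\<in>UNIV. x $ j *\<^sub>R axis j 1) \<in> span S" by (rule span_sum)
  also have "(\<Sum>j\<in>UNIV. x $ j *\<^sub>R axis j 1) = x"
    using basis_expansion[of x] by (simp add: scalar_mult_eq_scaleR)
  finally show "x \<in> span S" .
qed

section \<open>Sequences in which no vector lies in the span of its predecessors\<close>

lemma triangular_independent: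
  fixes b :: "nat \<Rightarrow> 'a :: real_vector"
  assumes "\<And>m. m < n \<Longrightarrow> b m \<notin> span (b ` {..<m})"
  shows "inj_on b {..<n}" "independent (b ` {..<n})"
proof -
  have "inj_on b {..<n} \<and> independent (b ` {..<n})" using assms
  proof (induction n)
    case (Suc n)
    have n: "b n \<notin> span (b ` {..<n})" by (rule Suc.prems) simp
    then have "b n \<notin> b ` {..<n}" by (metis span_base)
    moreover have "inj_on b {..<n} \<and> independent (b ` {..<n})"
      by (rule Suc.IH) (simp add: Suc.prems)
    ultimately show ?case
      using independent_insertI[OF n] by (simp add: lessThan_Suc)
  qed (simp add: independent_empty)
  then show "inj_on b {..<n}" "independent (b ` {..<n})" by auto
qed

lemma triangular_coeffs_zero:
  fixes b :: "nat \<Rightarrow> 'a :: real_vector"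
  assumes "\<And>m. m < n \<Longrightarrow> b m \<notin> span (b ` {..<m})" "(\<Sum>m<n. a m *\<^sub>R b m) = 0" "m < n"
  shows "a m = 0"
  using assms
proof (induction n)
  case (Suc n)
  have "a n = 0"
  proof (rule ccontr)
    assume "a n \<noteq> 0"
    have "(\<Sum>m<n. a m *\<^sub>R b m) \<in> span (b ` {..<n})"
      by (intro span_sum span_scale span_base) auto
    moreover have "a n *\<^sub>R b n = - (\<Sum>m<n. a m *\<^sub>R b m)"
      using Suc.prems(2) by (simp add: eq_neg_iff_add_eq_0 add.commute)
    ultimately have "a n *\<^sub>R b n \<in> span (b ` {..<n})" by (simp add: span_neg)
    then have "(1 / a n) *\<^sub>R (a n *\<^sub>R b n) \<in> span (b ` {..<n})" by (rule span_scale)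
    then have "b n \<in> span (b ` {..<n})" using \<open>a n \<noteq> 0\<close> by simp
    moreover have "b n \<notin> span (b ` {..<n})" by (rule Suc.prems) simp
    ultimately show False by blast
  qed
  show ?case
  proof (cases "m = n")
    case False
    show ?thesis
    proof (rule Suc.IH)
      show "b r \<notin> span (b ` {..<r})" if "r < n" for r by (rule Suc.prems) (use that in simp)
    qed (use False Suc.prems(2,3) \<open>a n = 0\<close> in simp_all)
  qed (simp add: \<open>a n = 0\<close>)
qed simp

lemma triangular_coeffs_eq:
  fixes b :: "nat \<Rightarrow> 'a :: real_vector"
  assumes "\<And>m. m < n \<Longrightarrow> b m \<notin> span (b ` {..<m})"
    "(\<Sum>m<n. a m *\<^sub>R b m) = (\<Sum>m<n. a' m *\<^sub>R b m)" "m < n"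
  shows "a m = a' m"
proof -
  have "(\<Sum>m<n. (a m - a' m) *\<^sub>R b m) = 0"
    using assms(2) by (simp add: scaleR_diff_left sum_subtractf)
  from triangular_coeffs_zero[OF assms(1) this assms(3)] show ?thesis by simp
qed

lemma span_image_lessThanE:
  fixes b :: "nat \<Rightarrow> 'a :: real_vector"
  assumes "x \<in> span (b ` {..<n})"
  obtains a where "x = (\<Sum>m<n. a m *\<^sub>R b m)"
proof -
  have "\<exists>a. x = (\<Sum>m<n. a m *\<^sub>R b m)" using assms
  proof (induction n arbitrary: x)
    case (Suc n)
    from Suc.prems obtain k where "x - k *\<^sub>R b n \<in> span (b ` {..<n})"
      by (auto simp: lessThan_Suc span_insert)
    from Suc.IH[OF this] obtain a where "x - k *\<^sub>R b n = (\<Sum>m<n. a m *\<^sub>R b m)" by auto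
    then have "x = (\<Sum>m<Suc n. (a(n := k)) m *\<^sub>R b m)" by (simp add: algebra_simps)
    then show ?case by blast
  qed simp
  then show ?thesis using that by blast
qed

section \<open>Greedy minima and Minkowski's second theorem for a discrete group containing the
  integer lattice\<close>

locale superlattice =
  fixes L :: "(real ^ 'n) set"
  assumes lattice_subset: "lattice \<subseteq> L"
    and diff_closed: "\<And>x y. x \<in> L \<Longrightarrow> y \<in> L \<Longrightarrow> x - y \<in> L"
    and discrete: "\<And>r. finite {x \<in> L. infnorm x \<le> r}"
begin

lemma zero_in: "0 \<in> L"
  using lattice_subset zero_in_lattice by blast

lemma add_closed: "x \<in> L \<Longrightarrow> y \<in> L \<Longrightarrow> x + y \<in> L"
  using diff_closed[of x "0 - y"] diff_closed[OF zero_in, of y] by simp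

lemma sum_closed: "(\<And>i. i \<in> A \<Longrightarrow> f i \<in> L) \<Longrightarrow> (\<Sum>i\<in>A. f i) \<in> L"
  by (induction A rule: infinite_finite_induct) (auto intro: zero_in add_closed)

lemma scale_int_closed: "x \<in> L \<Longrightarrow> of_int k *\<^sub>R x \<in> L"
proof (induction k rule: int_induct[where k = 0])
  case (step1 i)
  then show ?case by (simp add: scaleR_left_distrib add_closed)
next
  case (step2 i)
  then show ?case by (simp add: scaleR_left_diff_distrib diff_closed)
qed (simp add: zero_in)

text \<open>Choose each \<open>b m\<close> as a shortest vector of the lattice in
  \<open>coord_space J\<close> outside the span of the earlier ones. Fewer than |J| vectors cannot
  span all axes of J, so a candidate exists; \<open>infnorm (b m)\<close> is then the successive
  minimum with index m + 1.\<close>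

lemma exists_greedy_minima:
  "\<exists>b :: nat \<Rightarrow> real ^ 'n. \<forall>m < card J. b m \<in> L \<inter> coord_space J \<and> b m \<notin> span (b ` {..<m}) \<and>
     (\<forall>w \<in> L \<inter> coord_space J. infnorm w < infnorm (b m) \<longrightarrow> w \<in> span (b ` {..<m}))"
proof -
  define P where "P f m r \<longleftrightarrow> m < card J \<longrightarrow> r \<in> L \<inter> coord_space J \<and> r \<notin> span (f ` {..<m}) \<and>
    (\<forall>w \<in> L \<inter> coord_space J. infnorm w < infnorm r \<longrightarrow> w \<in> span (f ` {..<m}))"
    for f :: "nat \<Rightarrow> real ^ 'n" and m r
  have "\<exists>f. \<forall>x. P f x (f x)"
  proof (rule dependent_wellorder_choice)
    fix r :: "real ^ 'n" and f g :: "nat \<Rightarrow> real ^ 'n" and x :: nat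
    assume "\<And>y. y < x \<Longrightarrow> f y = g y"
    then have "f ` {..<x} = g ` {..<x}" by auto
    then show "P f x r = P g x r" by (simp add: P_def)
  next
    fix m :: nat and f :: "nat \<Rightarrow> real ^ 'n"
    show "\<exists>r. P f m r"
    proof (cases "m < card J")
      case True
      define S where "S = L \<inter> coord_space J - span (f ` {..<m})"
      have "S \<noteq> {}"
      proof
        assume "S = {}"
        have "axis j 1 \<in> span (f ` {..<m})" if "j \<in> J" for j
          using axis_in_lattice[of j] lattice_subset axis_in_coord_space[OF that, of 1] \<open>S = {}\<close>
          by (auto simp: S_def)
        then have "dim (coord_space J) \<le> dim (span (f ` {..<m}))"
          by (intro dim_subset coord_space_subset_span)
        also have "\<dots> \<le> card (f ` {..<m})" by (simp add: dim_le_card')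
        also have "\<dots> \<le> m" using card_image_le[of "{..<m}" f] by simp
        finally show False using True by (simp add: dim_coord_space)
      qed
      then obtain x0 where x0: "x0 \<in> S" by auto
      \<comment> \<open>Only points no longer than x0 compete, and discreteness leaves finitely many
        of them, so the shortest length is attained.\<close>
      define S' where "S' = {x \<in> S. infnorm x \<le> infnorm x0}"
      have "finite S'" unfolding S'_def
        by (rule finite_subset[OF _ discrete[of "infnorm x0"]]) (auto simp: S_def)
      moreover have "S' \<noteq> {}" using x0 by (auto simp: S'_def)
      ultimately obtain r where r: "r \<in> S'" "\<And>y. y \<in> S' \<Longrightarrow> infnorm r \<le> infnorm y"
        by (meson arg_min_least arg_min_if_finite(1))
      have "w \<in> span (f ` {..<m})" if "w \<in> L \<inter> coord_space J" "infnorm w < infnorm r" for w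
      proof (rule ccontr)
        assume "w \<notin> span (f ` {..<m})"
        then have "w \<in> S'" using that r(1) by (auto simp: S_def S'_def)
        then show False using r(2) that(2) by force
      qed
      then have "P f m r" using r(1) by (auto simp: P_def S_def S'_def)
      then show ?thesis ..
    qed (simp add: P_def)
  qed
  then show ?thesis by (simp add: P_def)
qed

text \<open>Pigeonhole on the points \<open>\<Sum>\<^sub>m frac (k a\<^sub>m) b\<^sub>m\<close>, \<open>k = 0, 1, \<dots>\<close>, of the bounded, hence finite,
  part of \<open>L\<close>.\<close>

lemma common_denominator:
  fixes n :: nat
  assumes b: "\<And>m. m < n \<Longrightarrow> b m \<in> L" and ind: "\<And>m. m < n \<Longrightarrow> b m \<notin> span (b ` {..<m})"
  shows "\<exists>D::nat. D > 0 \<and> (\<forall>a. (\<Sum>m<n. a m *\<^sub>R b m) \<in> L \<longrightarrow> (\<forall>m<n. real D * a m \<in> \<int>))"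
proof -
  define B where "B = (\<Sum>m<n. infnorm (b m))"
  define F where "F = card {x \<in> L. infnorm x \<le> B}"
  have "real (fact F) * a m \<in> \<int>" if x: "(\<Sum>m<n. a m *\<^sub>R b m) \<in> L" and m: "m < n" for a m
  proof -
    define g where "g k = (\<Sum>m<n. frac (real k * a m) *\<^sub>R b m)" for k :: nat
    have "g k \<in> {x \<in> L. infnorm x \<le> B}" for k
    proof -
      have "g k = of_int (int k) *\<^sub>R (\<Sum>m<n. a m *\<^sub>R b m) - (\<Sum>m<n. of_int \<lfloor>real k * a m\<rfloor> *\<^sub>R b m)"
        by (simp add: g_def frac_def algebra_simps sum_subtractf scaleR_sum_right)
      moreover have "\<dots> \<in> L"
        by (intro diff_closed scale_int_closed[OF x]) (auto intro!: sum_closed scale_int_closed b)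
      moreover have "infnorm (g k) \<le> B" unfolding g_def B_def
      proof (rule order_trans[OF infnorm_sum_le], rule sum_mono)
        fix m
        show "infnorm (frac (real k * a m) *\<^sub>R b m) \<le> infnorm (b m)"
          using frac_ge_0[of "real k * a m"] frac_lt_1[of "real k * a m"] infnorm_pos_le[of "b m"]
          by (simp add: infnorm_mul mult_left_le_one_le)
      qed
      ultimately show ?thesis by simp
    qed
    then have "g ` {..F} \<subseteq> {x \<in> L. infnorm x \<le> B}" by auto
    then have "card (g ` {..F}) \<le> F" unfolding F_def by (intro card_mono discrete)
    \<comment> \<open>\<open>{..F}\<close> has F + 1 elements.\<close>
    then have "\<not> inj_on g {..F}" using card_image[of g "{..F}"] by auto
    then obtain k k' where k: "k \<le> F" "k' \<le> F" "k < k'" "g k = g k'"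
      unfolding inj_on_def by (metis atMost_iff linorder_neqE_nat)
    have "(\<Sum>m<n. frac (real k * a m) *\<^sub>R b m) = (\<Sum>m<n. frac (real k' * a m) *\<^sub>R b m)"
      using k(4) by (simp only: g_def)
    from triangular_coeffs_eq[OF ind this m] have "frac (real k * a m) = frac (real k' * a m)" .
    then have "real k' * a m - real k * a m = of_int (\<lfloor>real k' * a m\<rfloor> - \<lfloor>real k * a m\<rfloor>)"
      by (simp add: frac_def)
    moreover have "real k' * a m - real k * a m = real (k' - k) * a m"
      using k by (simp add: of_nat_diff left_diff_distrib)
    ultimately have "real (k' - k) * a m \<in> \<int>" by (metis Ints_of_int)
    \<comment> \<open>The gap lies between 1 and F and depends on a; the factorial is a multiple of
      every such gap, so one denominator serves all a and m.\<close>
    moreover have "k' - k dvd fact F" using k by (intro dvd_fact) auto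
    then obtain q where "fact F = (k' - k) * q" ..
    then have "real (fact F) * a m = of_int (int q) * (real (k' - k) * a m)"
      by (metis mult.assoc mult.commute of_nat_mult of_int_of_nat_eq)
    ultimately show ?thesis by (metis Ints_mult Ints_of_int)
  qed
  moreover have "(fact F :: nat) > 0" by simp
  ultimately show ?thesis by blast
qed

text \<open>A \<open>b j\<close> shorter than \<open>b i\<close> would lie in the span of the
  vectors before i, hence of those before j.\<close>

lemma greedy_infnorm_mono:
  assumes "\<And>m. m < card J \<Longrightarrow> b m \<in> L \<inter> coord_space J"
    and "\<And>m. m < card J \<Longrightarrow> b m \<notin> span (b ` {..<m})"
    and "\<And>m w. m < card J \<Longrightarrow> w \<in> L \<inter> coord_space J \<Longrightarrow> infnorm w < infnorm (b m)
      \<Longrightarrow> w \<in> span (b ` {..<m})"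
    and "i \<le> j" "j < card J"
  shows "infnorm (b i) \<le> infnorm (b j)"
proof (rule ccontr)
  assume "\<not> infnorm (b i) \<le> infnorm (b j)"
  then have "b j \<in> span (b ` {..<i})" using assms(3)[of i "b j"] assms(1,4,5) by auto
  also have "\<dots> \<subseteq> span (b ` {..<j})" using assms(4) by (intro span_mono image_mono) auto
  finally show False using assms(2,5) by blast
qed

text \<open>Dividing the \<open>b m\<close> by their common denominator D generates a lattice
  containing the part of L in \<open>coord_space J\<close>. The spans of initial segments do not
  change, so this is an adapted basis with \<open>\<mu> m = infnorm (b m)\<close>.\<close>

lemma minkowski_second:
  assumes b: "\<And>m. m < card J \<Longrightarrow> b m \<in> L \<inter> coord_space J"
    and ind: "\<And>m. m < card J \<Longrightarrow> b m \<notin> span (b ` {..<m})"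
    and min: "\<And>m w. m < card J \<Longrightarrow> w \<in> L \<inter> coord_space J \<Longrightarrow> infnorm w < infnorm (b m)
      \<Longrightarrow> w \<in> span (b ` {..<m})"
  shows "real (card (L \<inter> box_on J 1)) * (\<Prod>m<card J. infnorm (b m)) \<le> 1"
proof -
  let ?d = "card J"
  obtain D :: nat where D: "D > 0"
    and int: "\<And>a m. (\<Sum>m<?d. a m *\<^sub>R b m) \<in> L \<Longrightarrow> m < ?d \<Longrightarrow> real D * a m \<in> \<int>"
    using common_denominator[of ?d b] b ind by blast
  define c where "c m = (1 / real D) *\<^sub>R b m" for m
  have pt: "(\<Sum>m<?d. of_int (z m) *\<^sub>R c m) = (\<Sum>m<?d. (of_int (z m) / real D) *\<^sub>R b m)" for z
    by (simp add: c_def)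
  have c_in: "c m \<in> coord_space J" if "m < ?d" for m
    using b[OF that] by (auto simp: c_def intro: subspace_scale subspace_coord_space)
  have pt_in: "(\<Sum>m<?d. of_int (z m) *\<^sub>R c m) \<in> coord_space J" for z
    by (intro subspace_sum subspace_coord_space subspace_scale c_in) auto
  have dim_span: "coord_space J \<subseteq> span (b ` {..<?d})"
  proof (rule card_ge_dim_independent)
    show "dim (coord_space J) \<le> card (b ` {..<?d})"
      using triangular_independent(1)[of ?d b] ind by (simp add: dim_coord_space card_image)
  qed (use b triangular_independent(2)[of ?d b] ind in auto)
  have "adapted_basis L J c (\<lambda>m. infnorm (b m))"
  proof
    show "lattice \<inter> coord_space J \<subseteq> L" using lattice_subset by blast
    show "z m = 0" if "(\<Sum>m<?d. of_int (z m) *\<^sub>R c m) = 0" "m < ?d" for z m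
      using triangular_coeffs_zero[of ?d b "\<lambda>m. of_int (z m) / real D" m] that ind D by (simp add: pt)
    show "L \<inter> coord_space J \<subseteq> range (\<lambda>z. \<Sum>m<?d. of_int (z m) *\<^sub>R c m)"
    proof
      fix x assume x: "x \<in> L \<inter> coord_space J"
      then obtain a where a: "x = (\<Sum>m<?d. a m *\<^sub>R b m)"
        using span_image_lessThanE dim_span by blast
      have "of_int \<lfloor>real D * a m\<rfloor> / real D = a m" if "m < ?d" for m
        using int[of a m] x a that D by (auto simp: field_simps elim!: Ints_cases)
      then have "x = (\<Sum>m<?d. of_int \<lfloor>real D * a m\<rfloor> *\<^sub>R c m)"
        unfolding pt a by (intro sum.cong) auto
      then show "x \<in> range (\<lambda>z. \<Sum>m<?d. of_int (z m) *\<^sub>R c m)"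
        by (rule range_eqI[where x = "\<lambda>m. \<lfloor>real D * a m\<rfloor>"])
    qed
    show "finite (range (\<lambda>z. \<Sum>m<?d. of_int (z m) *\<^sub>R c m) \<inter> box_on J 1)"
    \<comment> \<open>Multiplication by D sends the finer lattice back into L, where bounded sets
      are finite.\<close>
    proof (rule inj_on_finite[where f = "\<lambda>x. real D *\<^sub>R x"])
      show "(\<lambda>x. real D *\<^sub>R x) ` (range (\<lambda>z. \<Sum>m<?d. of_int (z m) *\<^sub>R c m) \<inter> box_on J 1)
          \<subseteq> {x \<in> L. infnorm x \<le> real D}"
      proof safe
        fix z assume z: "(\<Sum>m<?d. of_int (z m) *\<^sub>R c m) \<in> box_on J 1"
        have "real D *\<^sub>R (\<Sum>m<?d. of_int (z m) *\<^sub>R c m) = (\<Sum>m<?d. of_int (z m) *\<^sub>R b m)"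
          using D by (simp add: pt scaleR_sum_right)
        also have "\<dots> \<in> L" using b by (intro sum_closed scale_int_closed) auto
        finally show "real D *\<^sub>R (\<Sum>m<?d. of_int (z m) *\<^sub>R c m) \<in> L" .
        have "infnorm ((\<Sum>m<?d. of_int (z m) *\<^sub>R c m) - 0) < 1"
          by (rule box_on_diff_less[OF z]) (auto simp: box_on_def coord_space_def)
        then show "infnorm (real D *\<^sub>R (\<Sum>m<?d. of_int (z m) *\<^sub>R c m)) \<le> real D"
          using D by (simp add: infnorm_mul)
      qed
    qed (use D in \<open>auto simp: inj_on_def intro: discrete\<close>)
    show "infnorm (b i) \<le> infnorm (b j)" if "i \<le> j" "j < ?d" for i j
      by (rule greedy_infnorm_mono[OF b ind min that])
    show "0 < infnorm (b m)" if "m < ?d" for m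
      using ind[OF that] by (auto simp: infnorm_pos_lt span_0)
    show "z m = 0" if "(\<Sum>m<?d. of_int (z m) *\<^sub>R c m) \<in> L" "m < ?d"
      "infnorm (\<Sum>m<?d. of_int (z m) *\<^sub>R c m) < infnorm (b m)" for z m
    proof -
      have "(\<Sum>m<?d. of_int (z m) *\<^sub>R c m) \<in> span (b ` {..<m})"
        using min[OF that(2) _ that(3)] that(1) pt_in by blast
      then obtain a where "(\<Sum>m<?d. of_int (z m) *\<^sub>R c m) = (\<Sum>r<m. a r *\<^sub>R b r)"
        by (rule span_image_lessThanE)
      also have "\<dots> = (\<Sum>r<?d. (if r < m then a r else 0) *\<^sub>R b r)"
        using that(2) by (intro sum.mono_neutral_cong_left) auto
      finally have eq: "(\<Sum>r<?d. (of_int (z r) / real D) *\<^sub>R b r)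
          = (\<Sum>r<?d. (if r < m then a r else 0) *\<^sub>R b r)"
        unfolding pt .
      from triangular_coeffs_eq[OF ind eq that(2)]
      have "of_int (z m) / real D = (if m < m then a m else 0)" .
      then show "z m = 0" using D by simp
    qed
  qed (use c_in diff_closed in auto)
  then show ?thesis by (rule adapted_basis.card_mult_prod_le_1)
qed

end

section \<open>Successive minima and coordinate subspaces\<close>

text \<open>Labels are given out downwards from n. If B carries the labels above k, then
  \<open>U k\<close> and \<open>coord_space B\<close> together have dimension less than k + (n - k)
  = n, so some axis lies outside their sum; its coordinate gets label k.\<close>

lemma exists_transversal_labelling:
  fixes U :: "nat \<Rightarrow> (real ^ 'n) set"
  assumes sub: "\<And>k. subspace (U k)"
    and mono: "\<And>i j. 1 \<le> i \<Longrightarrow> i \<le> j \<Longrightarrow> j \<le> CARD('n) \<Longrightarrow> U i \<subseteq> U j"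
    and dim: "\<And>k. 1 \<le> k \<Longrightarrow> k \<le> CARD('n) \<Longrightarrow> dim (U k) < k"
  shows "\<exists>\<pi>. bij_betw \<pi> UNIV {1..CARD('n)} \<and>
    (\<forall>k \<in> {1..CARD('n)}. coord_space {j. k \<le> \<pi> j} \<inter> U k \<subseteq> {0})"
proof -
  let ?n = "CARD('n)"
  have "\<exists>\<pi> B. bij_betw \<pi> B {1..?n} \<and>
    (\<forall>k \<in> {1..?n}. coord_space {j \<in> B. k \<le> \<pi> j} \<inter> U k \<subseteq> {0})"
  proof (rule inc_induct[of 1 "Suc ?n"])
    have "bij_betw (\<lambda>_ :: 'n. 0 :: nat) {} {Suc ?n..?n}" by (simp add: bij_betw_def)
    then show "\<exists>\<pi> B. bij_betw \<pi> B {Suc ?n..?n} \<and>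
      (\<forall>k \<in> {Suc ?n..?n}. coord_space {j \<in> B. k \<le> \<pi> j} \<inter> U k \<subseteq> {0})" by force
  next
    fix k assume k: "1 \<le> k" "k < Suc ?n"
    assume "\<exists>\<pi> B. bij_betw \<pi> B {Suc k..?n} \<and>
      (\<forall>l \<in> {Suc k..?n}. coord_space {j \<in> B. l \<le> \<pi> j} \<inter> U l \<subseteq> {0})"
    then obtain \<pi> B where bij: "bij_betw \<pi> B {Suc k..?n}"
      and trans: "\<And>l. l \<in> {Suc k..?n} \<Longrightarrow> coord_space {j \<in> B. l \<le> \<pi> j} \<inter> U l \<subseteq> {0}" by blast
    have card_B: "card B = ?n - k" using bij_betw_same_card[OF bij] by simp
    have Uk: "coord_space B \<inter> U k \<subseteq> {0}"
    \<comment> \<open>For k = n, \<open>mono\<close> gives no larger subspace to compare with, but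
      then B is empty.\<close>
    proof (cases "k = ?n")
      case True
      then have "B = {}" using card_B by (simp add: card_eq_0_iff)
      then show ?thesis by (auto simp: coord_space_def vec_eq_iff)
    next
      case False
      have "{j \<in> B. Suc k \<le> \<pi> j} = B" using bij by (auto simp: bij_betw_def)
      then have "coord_space B \<inter> U (Suc k) \<subseteq> {0}" using trans[of "Suc k"] k False by auto
      moreover have "U k \<subseteq> U (Suc k)" using k False by (intro mono) auto
      ultimately show ?thesis by blast
    qed
    define T where "T = {x + y | x y. x \<in> U k \<and> y \<in> coord_space B}"
    have T: "subspace T" unfolding T_def by (intro subspace_sums sub subspace_coord_space)
    have "dim T + dim (U k \<inter> coord_space B) = dim (U k) + dim (coord_space B)"
      unfolding T_def by (rule dim_sums_Int[OF sub subspace_coord_space])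
    then have "dim T < ?n" using dim[of k] k card_B by (simp add: dim_coord_space)
    moreover have "?n \<le> dim T" if "\<And>j. axis j 1 \<in> T"
      using dim_subset[OF coord_space_subset_span[of UNIV T, OF span_base[OF that]]]
      by (simp add: dim_coord_space[of UNIV, simplified])
    ultimately obtain j where j: "axis j 1 \<notin> T" by fastforce
    have "axis j 1 = 0 + axis j (1 :: real)" by simp
    then have jB: "j \<notin> B" using j axis_in_coord_space[of j B 1] subspace_0[OF sub[of k]]
      unfolding T_def by blast
    have new: "coord_space (insert j B) \<inter> U k \<subseteq> {0}"
    proof
      fix x assume x: "x \<in> coord_space (insert j B) \<inter> U k"
      define y where "y = x - x $ j *\<^sub>R axis j 1"
      have y: "- y \<in> coord_space B" using x by (auto simp: y_def coord_space_def axis_def)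
      \<comment> \<open>Otherwise \<open>axis j 1\<close> would be a multiple of x - y, which lies
        in the sum T avoided by the choice of j.\<close>
      have "x $ j = 0"
      proof (rule ccontr)
        assume "x $ j \<noteq> 0"
        have "x + - y \<in> T" using x y unfolding T_def by blast
        then have "(1 / x $ j) *\<^sub>R (x + - y) \<in> T" by (rule subspace_scale[OF T])
        then show False using j \<open>x $ j \<noteq> 0\<close> by (simp add: y_def)
      qed
      then have "x \<in> coord_space B" using x by (auto simp: coord_space_def)
      then show "x \<in> {0}" using x Uk by blast
    qed
    let ?\<pi> = "\<pi>(j := k)"
    have "bij_betw ?\<pi> (insert j B) {k..?n}"
    proof -
      have "bij_betw ?\<pi> B {Suc k..?n}"
        using bij jB by (subst bij_betw_cong[of B ?\<pi> \<pi>]) auto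
      moreover have "{k..?n} = insert k {Suc k..?n}" using k by auto
      ultimately show ?thesis using notIn_Un_bij_betw[of j B ?\<pi> "{Suc k..?n}"] jB by auto
    qed
    moreover have "coord_space {i \<in> insert j B. l \<le> ?\<pi> i} \<inter> U l \<subseteq> {0}" if "l \<in> {k..?n}" for l
    proof (cases "l = k")
      case True
      have "coord_space {i \<in> insert j B. l \<le> ?\<pi> i} \<subseteq> coord_space (insert j B)"
        by (intro coord_space_mono) auto
      then show ?thesis using new True by blast
    next
      case False
      have "{i \<in> insert j B. l \<le> ?\<pi> i} = {i \<in> B. l \<le> \<pi> i}" using False that jB by auto
      then show ?thesis using trans[of l] that False by auto
    qed
    ultimately show "\<exists>\<pi> B. bij_betw \<pi> B {k..?n} \<and>
      (\<forall>l \<in> {k..?n}. coord_space {j \<in> B. l \<le> \<pi> j} \<inter> U l \<subseteq> {0})" by blast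
  qed simp
  then obtain \<pi> B where bij: "bij_betw \<pi> B {1..?n}"
    and trans: "\<forall>k \<in> {1..?n}. coord_space {j \<in> B. k \<le> \<pi> j} \<inter> U k \<subseteq> {0}" by blast
  have "B = UNIV" using bij_betw_same_card[OF bij] by (simp add: card_eq_UNIV_imp_eq_UNIV)
  then show ?thesis using bij trans by auto
qed

section \<open>Successive minima of the lattice and the bound for each coordinate subset\<close>

context superlattice
begin

text \<open>Linear dimension takes the place of the \<open>aff_dim\<close> in
  \<open>succ_min\<close>; the sets contain 0 for t > 0, so the two agree.\<close>

definition minimum :: "nat \<Rightarrow> real" where
  "minimum k = Inf {t. t > 0 \<and> k \<le> dim {x \<in> L. infnorm x \<le> t}}"

lemma minimum_set_nonempty:
  assumes "k \<le> CARD('n)"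
  shows "1 \<in> {t. t > 0 \<and> k \<le> dim {x \<in> L. infnorm x \<le> t}}"
proof -
  have "axis j 1 \<in> span {x \<in> L. infnorm x \<le> 1}" for j
    using axis_in_lattice lattice_subset
    by (intro span_base) (auto simp: infnorm_le_iff_cart axis_def)
  then have "dim (coord_space (UNIV :: 'n set)) \<le> dim {x \<in> L. infnorm x \<le> 1}"
    using dim_subset[OF coord_space_subset_span[of UNIV "{x \<in> L. infnorm x \<le> 1}"]] by simp
  then show ?thesis using assms by (simp add: dim_coord_space)
qed

lemma minimum_bdd_below: "bdd_below {t. t > 0 \<and> k \<le> dim {x \<in> L. infnorm x \<le> t}}"
  by (rule bdd_belowI[of _ 0]) auto

lemma minimum_mono:
  assumes "i \<le> j" "j \<le> CARD('n)"
  shows "minimum i \<le> minimum j"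
  unfolding minimum_def
proof (rule cInf_superset_mono[OF _ minimum_bdd_below])
  show "{t. t > 0 \<and> j \<le> dim {x \<in> L. infnorm x \<le> t}} \<noteq> {}"
    using minimum_set_nonempty[OF assms(2)] by blast
qed (use assms(1) in auto)

lemma minimum_pos:
  assumes "1 \<le> k" "k \<le> CARD('n)"
  shows "0 < minimum k"
proof -
  define F where "F = {x \<in> L. infnorm x \<le> 1} - {0}"
  have F: "finite F" unfolding F_def using discrete by simp
  \<comment> \<open>Inserting 1 keeps \<open>Min\<close> meaningful for empty F and ensures that
    nonzero lattice points shorter than \<epsilon> would belong to F.\<close>
  define \<epsilon> where "\<epsilon> = Min (insert 1 (infnorm ` F))"
  have "\<epsilon> > 0" unfolding \<epsilon>_def using F by (subst Min_gr_iff) (auto simp: F_def infnorm_pos_lt)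
  have "\<epsilon> \<le> 1" unfolding \<epsilon>_def using F by simp
  have "\<epsilon> \<le> minimum k" unfolding minimum_def
  proof (rule cInf_greatest)
    fix t assume t: "t \<in> {t. t > 0 \<and> k \<le> dim {x \<in> L. infnorm x \<le> t}}"
    show "\<epsilon> \<le> t"
    proof (rule ccontr)
      assume "\<not> \<epsilon> \<le> t"
      have "{x \<in> L. infnorm x \<le> t} \<subseteq> {0}"
      proof
        fix x assume x: "x \<in> {x \<in> L. infnorm x \<le> t}"
        show "x \<in> {0}"
        proof (rule ccontr)
          assume "x \<notin> {0}"
          then have "x \<in> F" using x \<open>\<not> \<epsilon> \<le> t\<close> \<open>\<epsilon> \<le> 1\<close> by (simp add: F_def)
          then have "\<epsilon> \<le> infnorm x" unfolding \<epsilon>_def using F by simp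
          then show False using x \<open>\<not> \<epsilon> \<le> t\<close> by simp
        qed
      qed
      then have "dim {x \<in> L. infnorm x \<le> t} = 0" by (simp only: dim_eq_0)
      moreover have "k \<le> dim {x \<in> L. infnorm x \<le> t}" using t by blast
      ultimately show False using assms by linarith
    qed
  qed (use minimum_set_nonempty[OF assms(2)] in blast)
  then show ?thesis using \<open>\<epsilon> > 0\<close> by simp
qed

text \<open>Finitely many lattice points are shorter than \<open>minimum k\<close>, so their largest
  norm t is still strictly smaller. Dimension k would make t admissible in the infimum.\<close>

lemma dim_below_minimum:
  assumes "1 \<le> k"
  shows "dim {x \<in> L. infnorm x < minimum k} < k"
proof (rule ccontr)
  define A where "A = {x \<in> L. infnorm x < minimum k}"
  assume "\<not> dim {x \<in> L. infnorm x < minimum k} < k"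
  then have k: "k \<le> dim A" by (simp add: A_def)
  have A: "finite A" unfolding A_def by (rule finite_subset[OF _ discrete[of "minimum k"]]) auto
  have "\<not> A \<subseteq> {0}" using k assms dim_eq_0[of A] by linarith
  then obtain x where x: "x \<in> A" "x \<noteq> 0" by auto
  define t where "t = Max (infnorm ` A)"
  have le: "infnorm y \<le> t" if "y \<in> A" for y unfolding t_def using A that by simp
  have "t < minimum k" unfolding t_def using A x by (subst Max_less_iff) (auto simp: A_def)
  moreover have "t > 0" using le[OF x(1)] x(2) by (meson infnorm_pos_lt less_le_trans)
  moreover have "dim A \<le> dim {x \<in> L. infnorm x \<le> t}"
    using le by (intro dim_subset) (auto simp: A_def)
  ultimately have "minimum k \<le> t" unfolding minimum_def
    using k by (intro cInf_lower minimum_bdd_below) auto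
  then show False using \<open>t < minimum k\<close> by simp
qed

text \<open>The subspace \<open>U\<^sub>k\<close> of the proof idea.\<close>

definition below :: "nat \<Rightarrow> (real ^ 'n) set" where
  "below k = span {x \<in> L. infnorm x < minimum k}"

text \<open>Let s list the labels of J increasingly, and suppose \<open>b m\<close> is shorter than
  \<open>minimum (s m)\<close>. Then \<open>b 0\<close>, ..., \<open>b m\<close> span m + 1
  dimensions inside \<open>below (s m)\<close>, which meets the space of the |J| - m coordinates
  with label at least \<open>s m\<close> only in 0. Both lie in \<open>coord_space J\<close>, of
  dimension |J|: too small. Hence \<open>minkowski_second\<close> yields the bound.\<close>

lemma card_box_le_prod_minimum:
  assumes bij: "bij_betw \<pi> UNIV {1..CARD('n)}"
    and trans: "\<And>k. k \<in> {1..CARD('n)} \<Longrightarrow> coord_space {j. k \<le> \<pi> j} \<inter> below k \<subseteq> {0}"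
  shows "real (card (L \<inter> box_on J 1)) \<le> (\<Prod>j\<in>J. 1 / minimum (\<pi> j))"
proof -
  have inj: "inj_on \<pi> J" using bij inj_on_subset[of \<pi> UNIV J] by (simp add: bij_betw_def)
  have range: "\<pi> j \<in> {1..CARD('n)}" for j using bij_betwE[OF bij] by blast
  obtain b where b: "\<And>m. m < card J \<Longrightarrow> b m \<in> L \<inter> coord_space J"
    and ind: "\<And>m. m < card J \<Longrightarrow> b m \<notin> span (b ` {..<m})"
    and min: "\<And>m w. m < card J \<Longrightarrow> w \<in> L \<inter> coord_space J \<Longrightarrow> infnorm w < infnorm (b m)
      \<Longrightarrow> w \<in> span (b ` {..<m})"
    using exists_greedy_minima[of J] by metis
  obtain s where "bij_betw s {..<card (\<pi> ` J)} (\<pi> ` J)" "strict_mono_on {..<card (\<pi> ` J)} s"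
    by (rule ex_bij_betw_strict_mono_card[of "\<pi> ` J"]) simp_all
  note s = this[unfolded card_image[OF inj]]
  have s_in: "s m \<in> \<pi> ` J" if "m < card J" for m
    using bij_betwE[OF s(1)] that by simp
  have lower: "minimum (s m) \<le> infnorm (b m)" if m: "m < card J" for m
  proof (rule ccontr)
    assume less: "\<not> minimum (s m) \<le> infnorm (b m)"
    let ?k = "s m"
    let ?J' = "{j \<in> J. ?k \<le> \<pi> j}"
    obtain j where "?k = \<pi> j" using s_in[OF m] by blast
    then have k: "?k \<in> {1..CARD('n)}" using range[of j] by simp
    have sub: "subspace (below ?k \<inter> coord_space J)"
      unfolding below_def by (intro subspace_inter subspace_span subspace_coord_space)
    have "b ` {..<Suc m} \<subseteq> below ?k \<inter> coord_space J"
    proof safe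
      fix r assume r: "r < Suc m"
      have "infnorm (b r) \<le> infnorm (b m)"
        by (rule greedy_infnorm_mono[OF b ind min]) (use r m in auto)
      then show "b r \<in> below ?k" using b[of r] r m less
        unfolding below_def by (intro span_base) auto
      show "b r \<in> coord_space J" using b[of r] r m by auto
    qed
    moreover have "\<And>r. r < Suc m \<Longrightarrow> b r \<notin> span (b ` {..<r})" using ind m by simp
    note tri = triangular_independent[of "Suc m" b, OF this]
    ultimately have "card (b ` {..<Suc m}) \<le> dim (below ?k \<inter> coord_space J)"
      by (intro independent_card_le_dim)
    then have "Suc m \<le> dim (below ?k \<inter> coord_space J)" using tri(1) by (simp add: card_image)
    moreover have "dim (below ?k \<inter> coord_space J) + dim (coord_space ?J') \<le> card J"
    proof -
      let ?A = "below ?k \<inter> coord_space J"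
      have "coord_space ?J' \<subseteq> coord_space {j. ?k \<le> \<pi> j}" "coord_space ?J' \<subseteq> coord_space J"
        by (intro coord_space_mono; auto)+
      then have "?A \<inter> coord_space ?J' \<subseteq> {0}" using trans[OF k] by blast
      then have "dim (?A \<inter> coord_space ?J') = 0" by (simp only: dim_eq_0)
      then have "dim ?A + dim (coord_space ?J') = dim {x + y | x y. x \<in> ?A \<and> y \<in> coord_space ?J'}"
        using dim_sums_Int[OF sub subspace_coord_space[of ?J']] by linarith
      also have "\<dots> \<le> dim (coord_space J)"
        using \<open>coord_space ?J' \<subseteq> coord_space J\<close>
        by (intro dim_subset) (auto intro: subspace_add subspace_coord_space)
      finally show ?thesis by (simp add: dim_coord_space)
    qed
    \<comment> \<open>Since s is increasing and starts at index 0, the labels of J from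
      \<open>s m\<close> on are the values of s at m, ..., |J| - 1.\<close>
    moreover have "card ?J' = card J - m"
    proof -
      have "s ` {m..<card J} = \<pi> ` ?J'"
      proof
        show "s ` {m..<card J} \<subseteq> \<pi> ` ?J'"
        proof
          fix x assume "x \<in> s ` {m..<card J}"
          then obtain r where r: "x = s r" "m \<le> r" "r < card J" by auto
          then have "s m \<le> s r"
            using strict_mono_onD[OF s(2), of m r] m by (cases "m = r") auto
          moreover obtain j where "j \<in> J" "s r = \<pi> j" using s_in[OF r(3)] by auto
          ultimately show "x \<in> \<pi> ` ?J'" using r(1) by auto
        qed
        show "\<pi> ` ?J' \<subseteq> s ` {m..<card J}"
        proof
          fix x assume "x \<in> \<pi> ` ?J'"
          then obtain j where j: "x = \<pi> j" "j \<in> J" "s m \<le> \<pi> j" by auto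
          then obtain r where r: "r < card J" "\<pi> j = s r" using s(1) by (auto simp: bij_betw_def)
          then have "m \<le> r" using strict_mono_onD[OF s(2), of r m] m j(3) by force
          then show "x \<in> s ` {m..<card J}" using r j(1) by auto
        qed
      qed
      moreover have "inj_on s {m..<card J}"
        by (rule inj_on_subset[OF bij_betw_imp_inj_on[OF s(1)]]) auto
      moreover have "inj_on \<pi> ?J'" by (rule inj_on_subset[OF inj]) auto
      ultimately show ?thesis
        using card_image[of s "{m..<card J}"] card_image[of \<pi> ?J'] by simp
    qed
    ultimately show False using m by (simp add: dim_coord_space)
  qed
  have pos: "0 < minimum (\<pi> j)" for j using minimum_pos range[of j] by auto
  have "(\<Prod>j\<in>J. minimum (\<pi> j)) = (\<Prod>k\<in>\<pi> ` J. minimum k)"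
    using inj by (simp add: prod.reindex)
  also have "\<dots> = (\<Prod>m<card J. minimum (s m))"
    using prod.reindex_bij_betw[OF s(1), of minimum] by simp
  also have "\<dots> \<le> (\<Prod>m<card J. infnorm (b m))"
  proof (rule prod_mono)
    fix m assume "m \<in> {..<card J}"
    then have m: "m < card J" by simp
    then obtain j where "s m = \<pi> j" using s_in by blast
    then show "0 \<le> minimum (s m) \<and> minimum (s m) \<le> infnorm (b m)" using pos[of j] lower[OF m] by simp
  qed
  finally have "real (card (L \<inter> box_on J 1)) * (\<Prod>j\<in>J. minimum (\<pi> j))
      \<le> real (card (L \<inter> box_on J 1)) * (\<Prod>m<card J. infnorm (b m))"
    by (rule mult_left_mono) simp
  also have "\<dots> \<le> 1" by (rule minkowski_second[OF b ind min])
  finally show ?thesis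
    using pos by (simp add: prod_dividef pos_le_divide_eq prod_pos)
qed

text \<open>As \<open>\<pi>\<close> does not depend on J, taking images under it matches the
  i-subsets of coordinates with the i-subsets of {1..n}, and the termwise bounds add up.\<close>

lemma sum_card_box_le:
  "(\<Sum>J | card J = i. real (card (L \<inter> box_on J 1)))
    \<le> (\<Sum>S | S \<subseteq> {1..CARD('n)} \<and> card S = i. \<Prod>k\<in>S. 1 / minimum k)"
proof -
  have mono: "below i \<subseteq> below j" if "i \<le> j" "j \<le> CARD('n)" for i j
    unfolding below_def using minimum_mono[OF that] by (intro span_mono) auto
  have "\<exists>\<pi>. bij_betw \<pi> UNIV {1..CARD('n)} \<and>
    (\<forall>k \<in> {1..CARD('n)}. coord_space {j :: 'n. k \<le> \<pi> j} \<inter> below k \<subseteq> {0})"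
    by (rule exists_transversal_labelling)
      (use mono dim_below_minimum in \<open>auto simp: below_def\<close>)
  then obtain \<pi> where bij: "bij_betw \<pi> UNIV {1..CARD('n)}"
    and trans: "\<And>k. k \<in> {1..CARD('n)} \<Longrightarrow> coord_space {j :: 'n. k \<le> \<pi> j} \<inter> below k \<subseteq> {0}" by blast
  have inj: "inj \<pi>" and ran: "range \<pi> = {1..CARD('n)}" using bij by (auto simp: bij_betw_def)
  have "bij_betw ((`) \<pi>) {J. card J = i} {S. S \<subseteq> {1..CARD('n)} \<and> card S = i}"
  proof (rule bij_betwI')
    fix S assume "S \<in> {S. S \<subseteq> {1..CARD('n)} \<and> card S = i}"
    then have "S = \<pi> ` (\<pi> -` S)" "card S = i" using ran by auto
    moreover from this have "card (\<pi> -` S) = i"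
      using inj by (metis card_image inj_on_subset subset_UNIV)
    ultimately show "\<exists>J \<in> {J. card J = i}. S = \<pi> ` J" by blast
  qed (use inj ran in \<open>auto simp: inj_image_eq_iff card_image inj_on_subset[OF inj]\<close>)
  then have "(\<Sum>S | S \<subseteq> {1..CARD('n)} \<and> card S = i. \<Prod>k\<in>S. 1 / minimum k)
      = (\<Sum>J | card J = i. \<Prod>k\<in>\<pi> ` J. 1 / minimum k)"
    by (rule sum.reindex_bij_betw[symmetric])
  also have "\<dots> = (\<Sum>J | card J = i. \<Prod>j\<in>J. 1 / minimum (\<pi> j))"
    using inj by (intro sum.cong refl) (simp add: prod.reindex inj_on_subset)
  also have "\<dots> \<ge> (\<Sum>J | card J = i. real (card (L \<inter> box_on J 1)))"
    by (intro sum_mono card_box_le_prod_minimum[OF bij trans])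
  finally show ?thesis .
qed

end

section \<open>The Ehrhart polynomial of a lattice parallelepiped\<close>

text \<open>A translation by (K, ..., K) moves the ball into a half-open box whose lattice points
  are already counted.\<close>

lemma finite_lattice_bounded: "finite {x \<in> lattice :: (real ^ 'n) set. infnorm x \<le> r}"
proof -
  define K where "K = nat \<lceil>r\<rceil> + 1"
  have K: "r < real K" unfolding K_def by linarith
  define w :: "real ^ 'n" where "w = (\<chi> i. real K)"
  have "card (lattice \<inter> box_on (UNIV :: 'n set) (real (2 * K))) > 0"
    by (simp only: card_lattice_box_on) (simp add: K_def)
  then have "finite (lattice \<inter> box_on (UNIV :: 'n set) (real (2 * K)))" by (rule card_ge_0_finite)
  moreover have "(\<lambda>x. x + w) ` {x \<in> lattice. infnorm x \<le> r} \<subseteq> lattice \<inter> box_on UNIV (real (2 * K))"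
  proof safe
    fix x :: "real ^ 'n" assume x: "x \<in> lattice" "infnorm x \<le> r"
    show "x + w \<in> lattice" using x(1) by (auto simp: lattice_def w_def)
    have "0 \<le> x $ i + real K \<and> x $ i + real K < 2 * real K" for i
    proof -
      have "\<bar>x $ i\<bar> \<le> r" using x(2) by (simp add: infnorm_le_iff_cart)
      then show ?thesis using K by linarith
    qed
    then show "x + w \<in> box_on UNIV (real (2 * K))"
      by (simp add: box_on_def coord_space_def w_def)
  qed
  ultimately show ?thesis
    using inj_on_finite[of "\<lambda>x. x + w", OF inj_on_add'] by blast
qed

context superlattice
begin

lemma finite_box_on: "finite (L \<inter> box_on J r)"
\<comment> \<open>For negative r and empty J the box is {0}, hence the maximum with 0.\<close>
proof (rule finite_subset[OF _ discrete[of "max r 0"]])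
  show "L \<inter> box_on J r \<subseteq> {x \<in> L. infnorm x \<le> max r 0}"
  proof safe
    fix x assume x: "x \<in> box_on J r"
    show "infnorm x \<le> max r 0" unfolding infnorm_le_iff_cart
    proof
      fix i
      show "\<bar>x $ i\<bar> \<le> max r 0"
        using x by (cases "i \<in> J") (auto simp: box_on_def coord_space_def le_max_iff_disj)
    qed
  qed
qed

text \<open>By \<open>[0, k] = [0, k) \<union> {k}\<close> in each coordinate; \<open>J\<close> collects the coordinates in \<open>[0, k)\<close>.\<close>

lemma card_closed_box:
  "card {x \<in> L. \<forall>i. 0 \<le> x $ i \<and> x $ i \<le> real k}
    = (\<Sum>J\<in>UNIV. k ^ card J * card (L \<inter> box_on J 1))"
proof -
  \<comment> \<open>Adding \<open>corner J\<close> sets the coordinates outside J to k; the witness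
    recovers J as the coordinates below k.\<close>
  define corner :: "'n set \<Rightarrow> real ^ 'n" where "corner J = (\<chi> i. if i \<in> J then 0 else real k)" for J
  have corner: "corner J \<in> L" for J
    using lattice_subset by (force simp: lattice_def corner_def)
  have "bij_betw (\<lambda>(J, x). x + corner J) (Sigma UNIV (\<lambda>J. L \<inter> box_on J (real k)))
          {x \<in> L. \<forall>i. 0 \<le> x $ i \<and> x $ i \<le> real k}"
  proof (rule bij_betw_byWitness[where f' = "\<lambda>x. ({i. x $ i < real k}, x - corner {i. x $ i < real k})"])
    show "\<forall>a\<in>Sigma UNIV (\<lambda>J. L \<inter> box_on J (real k)).
      (\<lambda>x. ({i. x $ i < real k}, x - corner {i. x $ i < real k})) ((\<lambda>(J, x). x + corner J) a) = a"
    proof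
      fix a assume "a \<in> Sigma UNIV (\<lambda>J. L \<inter> box_on J (real k))"
      then obtain J x where a: "a = (J, x)" "x \<in> box_on J (real k)" by auto
      then have "{i. (x + corner J) $ i < real k} = J"
        by (auto simp: box_on_def coord_space_def corner_def split: if_splits)
      then show "(\<lambda>x. ({i. x $ i < real k}, x - corner {i. x $ i < real k})) ((\<lambda>(J, x). x + corner J) a) = a"
        by (simp add: a)
    qed
  next
    show "\<forall>a\<in>{x \<in> L. \<forall>i. 0 \<le> x $ i \<and> x $ i \<le> real k}.
      (\<lambda>(J, x). x + corner J) ({i. a $ i < real k}, a - corner {i. a $ i < real k}) = a" by simp
  next
    show "(\<lambda>(J, x). x + corner J) ` Sigma UNIV (\<lambda>J. L \<inter> box_on J (real k))
        \<subseteq> {x \<in> L. \<forall>i. 0 \<le> x $ i \<and> x $ i \<le> real k}"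
    proof safe
      fix J :: "'n set" and x i assume x: "x \<in> L" "x \<in> box_on J (real k)"
      show "x + corner J \<in> L" using x corner by (intro add_closed)
      show "0 \<le> (x + corner J) $ i" "(x + corner J) $ i \<le> real k"
        using x(2) by (cases "i \<in> J"; auto simp: box_on_def coord_space_def corner_def less_imp_le)+
    qed
  next
    show "(\<lambda>x. ({i. x $ i < real k}, x - corner {i. x $ i < real k})) `
        {x \<in> L. \<forall>i. 0 \<le> x $ i \<and> x $ i \<le> real k} \<subseteq> Sigma UNIV (\<lambda>J. L \<inter> box_on J (real k))"
    proof safe
      fix x assume x: "x \<in> L" "\<forall>i. 0 \<le> x $ i \<and> x $ i \<le> real k"
      show "x - corner {i. x $ i < real k} \<in> L" using x(1) corner by (intro diff_closed)
      have "x $ i = real k" if "\<not> x $ i < real k" for i using x(2) that by (meson antisym not_less)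
      then show "x - corner {i. x $ i < real k} \<in> box_on {i. x $ i < real k} (real k)"
        using x(2) by (auto simp: box_on_def coord_space_def corner_def)
    qed simp
  qed
  then have "card {x \<in> L. \<forall>i. 0 \<le> x $ i \<and> x $ i \<le> real k}
      = (\<Sum>J\<in>UNIV. card (L \<inter> box_on J (real k)))"
    by (simp add: bij_betw_same_card[symmetric] card_SigmaI finite_box_on)
  also have "\<dots> = (\<Sum>J\<in>UNIV. k ^ card J * card (L \<inter> box_on J 1))"
    using lattice_subset by (intro sum.cong refl card_box_on_scale diff_closed) auto
  finally show ?thesis .
qed

end

text \<open>The \<open>THE\<close> is resolved by uniqueness: two polynomials of degree at most n
  that agree at the n + 1 points 0, ..., n are equal.\<close>

lemma ehrhart_coeff_eq:
  fixes P :: "(real ^ 'n) set"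
  assumes "\<And>k. real (card (((\<lambda>x. real k *\<^sub>R x) ` P) \<inter> lattice)) = poly q (real k)"
    and "degree q \<le> CARD('n)"
  shows "ehrhart_coeff P i = coeff q i"
proof -
  have "ehrhart_poly P = q" unfolding ehrhart_poly_def
  proof (rule the_equality)
    fix r :: "real poly"
    assume r: "degree r \<le> CARD('n) \<and>
      (\<forall>k. poly r (real k) = real (card (((\<lambda>x. real k *\<^sub>R x) ` P) \<inter> lattice)))"
    show "r = q"
    proof (rule poly_eqI_degree)
      show "poly r x = poly q x" if "x \<in> real ` {..CARD('n)}" for x using r assms(1) that by auto
      have "card (real ` {..CARD('n)}) = Suc (CARD('n))" by (subst card_image) auto
      then show "degree r < card (real ` {..CARD('n)})" "degree q < card (real ` {..CARD('n)})"
        using r assms(2) by auto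
    qed
  qed (use assms in auto)
  then show ?thesis by (simp add: ehrhart_coeff_def)
qed

section \<open>Transfer to the unit cube by the coordinates of the edge vectors\<close>

locale lattice_parallelepiped =
  fixes p :: "real ^ 'n" and v :: "'n \<Rightarrow> real ^ 'n"
  assumes p: "p \<in> lattice" and v: "\<And>i. v i \<in> lattice"
    and full_dim: "aff_dim (parallelepiped p v) = int CARD('n)"
begin

definition comb :: "real ^ 'n \<Rightarrow> real ^ 'n" where
  "comb s = (\<Sum>i\<in>UNIV. s $ i *\<^sub>R v i)"

definition coord_lattice :: "(real ^ 'n) set" where
  "coord_lattice = {s. comb s \<in> lattice}"

lemma linear_comb: "linear comb"
  by (rule linearI) (simp_all add: comb_def algebra_simps sum.distrib scaleR_sum_right)

lemma parallelepiped_eq: "parallelepiped p v = (\<lambda>s. p + comb s) ` {s. \<forall>i. 0 \<le> s $ i \<and> s $ i \<le> 1}"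
proof (intro set_eqI iffI)
  fix x assume "x \<in> parallelepiped p v"
  then obtain t where t: "x = p + (\<Sum>i\<in>UNIV. t i *\<^sub>R v i)" "\<forall>i. 0 \<le> t i \<and> t i \<le> 1"
    by (auto simp: parallelepiped_def)
  then show "x \<in> (\<lambda>s. p + comb s) ` {s. \<forall>i. 0 \<le> s $ i \<and> s $ i \<le> 1}"
    by (intro image_eqI[of _ _ "\<chi> i. t i"]) (auto simp: comb_def)
qed (force simp: parallelepiped_def comb_def)

text \<open>The parallelepiped lies in a translate of the range of \<open>comb\<close>; full
  dimension makes \<open>comb\<close> surjective, hence injective.\<close>

lemma inj_comb: "inj comb"
proof -
  have "parallelepiped p v \<subseteq> (+) p ` range comb" by (auto simp: parallelepiped_eq)
  then have "int CARD('n) \<le> aff_dim ((+) p ` range comb)"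
    unfolding full_dim[symmetric] by (rule aff_dim_subset)
  also have "\<dots> = int (dim (range comb))"
    using subspace_UNIV linear_subspace_image[OF linear_comb]
    by (simp add: aff_dim_translation_eq aff_dim_subspace)
  finally have "dim (range comb) = DIM(real ^ 'n)"
    using dim_subset_UNIV[of "range comb"] by simp
  then have "span (range comb) = UNIV" by (simp only: dim_eq_full)
  then have "surj comb"
    using linear_subspace_image[OF linear_comb subspace_UNIV] by (metis span_eq_iff)
  then show ?thesis using linear_surjective_imp_injective[OF linear_comb] by blast
qed

sublocale superlattice coord_lattice
proof
  show "lattice \<subseteq> coord_lattice"
  proof
    fix s :: "real ^ 'n" assume "s \<in> lattice"
    then have "(\<Sum>i\<in>UNIV. s $ i *\<^sub>R v i) $ j \<in> \<int>" for j
      using v by (auto simp: lattice_def intro!: Ints_sum Ints_mult)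
    then show "s \<in> coord_lattice" by (simp add: coord_lattice_def lattice_def comb_def)
  qed
  show "x - y \<in> coord_lattice" if "x \<in> coord_lattice" "y \<in> coord_lattice" for x y
    using that by (simp add: coord_lattice_def linear_diff[OF linear_comb] lattice_diff)
  show "finite {x \<in> coord_lattice. infnorm x \<le> r}" for r
  proof (rule inj_on_finite[where f = comb])
    show "comb ` {x \<in> coord_lattice. infnorm x \<le> r}
        \<subseteq> {x \<in> lattice. infnorm x \<le> (\<Sum>i\<in>UNIV. r * infnorm (v i))}"
    proof safe
      fix x assume x: "x \<in> coord_lattice" "infnorm x \<le> r"
      then show "comb x \<in> lattice" by (simp add: coord_lattice_def)
      show "infnorm (comb x) \<le> (\<Sum>i\<in>UNIV. r * infnorm (v i))" unfolding comb_def
      proof (rule order_trans[OF infnorm_sum_le], rule sum_mono)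
        fix i
        have "\<bar>x $ i\<bar> \<le> r" using x(2) by (simp add: infnorm_le_iff_cart)
        then show "infnorm (x $ i *\<^sub>R v i) \<le> r * infnorm (v i)"
          by (simp add: infnorm_mul mult_right_mono infnorm_pos_le)
      qed
    qed
  qed (use inj_comb finite_lattice_bounded in \<open>auto intro: inj_on_subset\<close>)
qed

text \<open>The base point cancels, and a vector of the cube [-1,1]^n is the difference of its
  positive and negative parts, both in [0,1]^n.\<close>

lemma diff_body_eq: "diff_body (parallelepiped p v) = comb ` {s. infnorm s \<le> 1}"
proof (intro set_eqI iffI)
  fix x assume "x \<in> diff_body (parallelepiped p v)"
  then obtain s t where st: "x = (p + comb s) - (p + comb t)"
    "\<forall>i. 0 \<le> s $ i \<and> s $ i \<le> 1" "\<forall>i. 0 \<le> t $ i \<and> t $ i \<le> 1"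
    by (auto simp: diff_body_def parallelepiped_eq)
  then have "x = comb (s - t)" by (simp add: linear_diff[OF linear_comb])
  moreover have "\<bar>(s - t) $ i\<bar> \<le> 1" for i using st(2,3)[rule_format, of i] by (simp add: abs_le_iff)
  ultimately show "x \<in> comb ` {s. infnorm s \<le> 1}" by (auto simp: infnorm_le_iff_cart)
next
  fix x assume "x \<in> comb ` {s. infnorm s \<le> 1}"
  then obtain s where s: "x = comb s" "\<And>i. \<bar>s $ i\<bar> \<le> 1" by (auto simp: infnorm_le_iff_cart)
  define a where "a = (\<chi> i. max 0 (s $ i))"
  define b where "b = (\<chi> i. max 0 (- s $ i))"
  have "s = a - b" by (auto simp: vec_eq_iff a_def b_def max_def)
  then have "x = (p + comb a) - (p + comb b)" by (simp add: s(1) linear_diff[OF linear_comb])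
  moreover have "0 \<le> a $ i \<and> a $ i \<le> 1" "0 \<le> b $ i \<and> b $ i \<le> 1" for i
    using s(2)[of i] by (auto simp: a_def b_def abs_le_iff)
  ultimately show "x \<in> diff_body (parallelepiped p v)"
    unfolding diff_body_def parallelepiped_eq by blast
qed

text \<open>For t > 0, \<open>comb\<close> maps the lattice points of norm at most t injectively
  onto the lattice points of the dilated difference body, so dimensions agree.\<close>

lemma succ_min_eq: "succ_min (diff_body (parallelepiped p v)) k = minimum k"
proof -
  have "aff_dim (((\<lambda>x. t *\<^sub>R x) ` diff_body (parallelepiped p v)) \<inter> lattice)
      = int (dim {x \<in> coord_lattice. infnorm x \<le> t})" if t: "t > 0" for t
  proof -
    have "((\<lambda>x. t *\<^sub>R x) ` diff_body (parallelepiped p v)) \<inter> lattice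
        = comb ` {x \<in> coord_lattice. infnorm x \<le> t}" (is "?A = ?B")
    proof
      show "?A \<subseteq> ?B"
      proof
        fix y assume y: "y \<in> ?A"
        then obtain s where s: "y = t *\<^sub>R comb s" "infnorm s \<le> 1" by (auto simp: diff_body_eq)
        then have "y = comb (t *\<^sub>R s)" "infnorm (t *\<^sub>R s) \<le> t"
          using t by (simp_all add: linear_cmul[OF linear_comb] infnorm_mul)
        then show "y \<in> ?B" using y by (auto simp: coord_lattice_def)
      qed
      show "?B \<subseteq> ?A"
      proof
        fix y assume "y \<in> ?B"
        then obtain s where s: "y = comb s" "comb s \<in> lattice" "infnorm s \<le> t"
          by (auto simp: coord_lattice_def)
        have "y = t *\<^sub>R comb ((1 / t) *\<^sub>R s)" "infnorm ((1 / t) *\<^sub>R s) \<le> 1"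
          using t s by (simp_all add: linear_cmul[OF linear_comb] infnorm_mul)
        then show "y \<in> ?A" using s by (auto simp: diff_body_eq)
      qed
    qed
    moreover have "0 \<in> ?B"
      using zero_in t by (intro image_eqI[of _ _ 0]) (auto simp: linear_0[OF linear_comb] infnorm_0)
    ultimately show ?thesis
      using dim_image_eq[OF linear_comb, of "{x \<in> coord_lattice. infnorm x \<le> t}"] inj_comb
      by (simp add: aff_dim_zero hull_inc inj_on_subset)
  qed
  then show ?thesis
    unfolding succ_min_def minimum_def by (intro arg_cong[where f = Inf]) auto
qed

text \<open>The translation by k p preserves the integer lattice, so only the injective linear part
  matters.\<close>

lemma card_dilate:
  "card (((\<lambda>x. real k *\<^sub>R x) ` parallelepiped p v) \<inter> lattice)
    = card {s \<in> coord_lattice. \<forall>i. 0 \<le> s $ i \<and> s $ i \<le> real k}"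
proof -
  have kp: "real k *\<^sub>R p \<in> lattice" using p by (intro lattice_scale_int) auto
  have iff: "real k *\<^sub>R p + comb s \<in> lattice \<longleftrightarrow> s \<in> coord_lattice" for s
    using lattice_add[OF kp, of "comb s"] lattice_diff[OF _ kp, of "real k *\<^sub>R p + comb s"]
    by (auto simp: coord_lattice_def)
  have "((\<lambda>x. real k *\<^sub>R x) ` parallelepiped p v)
      = (\<lambda>s. real k *\<^sub>R p + comb s) ` {s. \<forall>i. 0 \<le> s $ i \<and> s $ i \<le> real k}" (is "?A = ?B")
  proof
    show "?A \<subseteq> ?B"
    proof
      fix y assume "y \<in> ?A"
      then obtain s where s: "y = real k *\<^sub>R (p + comb s)" "\<forall>i. 0 \<le> s $ i \<and> s $ i \<le> 1"
        by (auto simp: parallelepiped_eq)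
      then show "y \<in> ?B"
        by (intro image_eqI[of _ _ "real k *\<^sub>R s"])
          (auto simp: linear_cmul[OF linear_comb] algebra_simps mult_left_le)
    qed
    show "?B \<subseteq> ?A"
    proof
      fix y assume "y \<in> ?B"
      then obtain s where s: "y = real k *\<^sub>R p + comb s" "\<forall>i. 0 \<le> s $ i \<and> s $ i \<le> real k" by auto
      \<comment> \<open>For \<open>k = 0\<close> this is 0, by the convention \<open>x / 0 = 0\<close>.\<close>
      define t where "t = (1 / real k) *\<^sub>R s"
      have "s = real k *\<^sub>R t"
      proof (cases "k = 0")
        case True
        then have "s = 0" using s(2) by (auto simp: vec_eq_iff intro: antisym)
        then show ?thesis by (simp add: t_def)
      qed (simp add: t_def)
      then have "y = real k *\<^sub>R (p + comb t)"
        using s(1) by (simp add: linear_cmul[OF linear_comb] algebra_simps)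
      moreover have "\<forall>i. 0 \<le> t $ i \<and> t $ i \<le> 1" using s(2) by (auto simp: t_def divide_le_eq_1)
      ultimately show "y \<in> ?A" unfolding parallelepiped_eq by blast
    qed
  qed
  then have "((\<lambda>x. real k *\<^sub>R x) ` parallelepiped p v) \<inter> lattice
      = (\<lambda>s. real k *\<^sub>R p + comb s) ` {s \<in> coord_lattice. \<forall>i. 0 \<le> s $ i \<and> s $ i \<le> real k}"
    using iff by auto
  moreover have "inj (\<lambda>s. real k *\<^sub>R p + comb s)" using inj_comb by (simp add: inj_def)
  ultimately show ?thesis by (simp add: card_image inj_on_subset)
qed

text \<open>\<open>card_closed_box\<close> exhibits the count as a polynomial in k; the exponent |J|
  sorts its terms by degree.\<close>

lemma ehrhart_coeff_parallelepiped:
  "ehrhart_coeff (parallelepiped p v) i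
    = (\<Sum>J | card J = i. real (card (coord_lattice \<inter> box_on J 1)))"
proof -
  define q :: "real poly" where
    "q = (\<Sum>J\<in>UNIV. monom (real (card (coord_lattice \<inter> box_on J 1))) (card J))"
  have "ehrhart_coeff (parallelepiped p v) i = coeff q i"
  proof (rule ehrhart_coeff_eq)
    show "real (card (((\<lambda>x. real k *\<^sub>R x) ` parallelepiped p v) \<inter> lattice)) = poly q (real k)" for k
      by (simp add: card_dilate card_closed_box q_def poly_sum poly_monom mult.commute)
    show "degree q \<le> CARD('n)" unfolding q_def
      by (intro degree_sum_le order_trans[OF degree_monom_le] card_mono) auto
  qed
  also have "\<dots> = (\<Sum>J\<in>UNIV. if card J = i then real (card (coord_lattice \<inter> box_on J 1)) else 0)"
    by (simp add: q_def coeff_sum)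
  also have "\<dots> = (\<Sum>J | card J = i. real (card (coord_lattice \<inter> box_on J 1)))"
    by (simp add: sum.inter_filter[symmetric])
  finally show ?thesis .
qed

lemma ehrhart_coeff_le_sigma:
  "ehrhart_coeff (parallelepiped p v) i \<le> sigma (parallelepiped p v) i"
  using sum_card_box_le[of i]
  by (simp add: ehrhart_coeff_parallelepiped sigma_def succ_min_eq)

end

theorem theorem1p4:
  fixes p :: "real ^ 'n" and v :: "'n \<Rightarrow> real ^ 'n"
  assumes "p \<in> lattice" and "\<forall>i. v i \<in> lattice"
    and "aff_dim (parallelepiped p v) = int CARD('n)"
  shows "\<forall>i \<le> CARD('n). ehrhart_coeff (parallelepiped p v) i \<le> sigma (parallelepiped p v) i"
proof -
  interpret lattice_parallelepiped p v using assms by unfold_locales auto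
  show ?thesis by (simp add: ehrhart_coeff_le_sigma)
qed

end
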